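(* Let $1\le m\le\infty$ and let $\{\mu_n:\bigotimes^nV\to V\}$ be an $A(m)$-structure on a graded vector space $V$. Then the maps $l_n:\bigotimes^nV\to V$ defined by $$l_n(v_1\otimes\cdots\otimes v_n):=\sum_{\sigma\in\mathcal S_n}\chi(\sigma;v_1,\ldots,v_n)\,\mu_n(v_{\sigma(1)}\otimes\cdots\otimes v_{\sigma(n)}),\qquad 1\le n\le m,\ n<\infty,$$ form an $L(m)$-structure on $V$. This correspondence $(V,\mu_n)\mapsto(V,l_n)$ defines a functor $(-)_L:\mathbf A(m)\to\mathbf L(m)$ from the category of $A(m)$-algebras to the category of $L(m)$-algebras.
   Context: All objects are over a fixed field $\mathbf k$ of characteristic zero; graded means $\mathbb Z$-graded; the Koszul sign convention is used (commuting things of degrees $p$ and $q$ gives the sign $(-1)^{pq}$). Signs. For homogeneous $x_1,\ldots,x_n$ and $\sigma\in\mathcal S_n$ (symmetric group), the Koszul sign $\epsilon(\sigma)=\epsilon(\sigma;x_1,\ldots,x_n)$ is defined by $x_1\wedge\cdots\wedge x_n=\epsilon(\sigma)\,x_{\sigma(1)}\wedge\cdots\wedge x_{\sigma(n)}$ in the free graded commutative algebra on $x_1,\ldots,x_n$; and $\chi(\sigma)=\chi(\sigma;x_1,\ldots,x_n):=\mathrm{sgn}(\sigma)\,\epsilon(\sigma;x_1,\ldots,x_n)$. A permutation $\sigma\in\mathcal S_n$ is a $(j,n-j)$-unshuffle if $\sigma(1)<\cdots<\sigma(j)$ and $\sigma(j+1)<\cdots<\sigma(n)$. $A(m)$-structure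 on a graded vector space $V$: a collection of linear maps $\mu_k:\bigotimes^kV\to V$, $1\le k\le m$, $k<\infty$, of degree $k-2$, such that for all finite $n$ with $1\le n\le m$ and homogeneous $a_1,\ldots,a_n\in V$ $$\sum_{\lambda=0}^{n-1}\sum_{k=1}^{n-\lambda}(-1)^{k+\lambda+k\lambda+nk+k(|a_1|+\cdots+|a_\lambda|)}\mu_{n-k+1}(a_1,\ldots,a_\lambda,\mu_k(a_{\lambda+1},\ldots,a_{\lambda+k}),a_{\lambda+k+1},\ldots,a_n)=0.$$ A morphism of $A(m)$-algebras $(V,\mu_n)\to(V',\mu'_n)$ is a degree $0$ linear map $f$ with $f\circ\mu_n=\mu_n'\circ f^{\otimes n}$ for all $1\le n\le m$, $n<\infty$. The resulting category is $\mathbf A(m)$. $L(m)$-structure on a graded vector space $L$: a collection of linear maps $l_k:\bigotimes^kL\to L$, $1\le k\le m$, $k<\infty$, of degree $k-2$, which are antisymmetric, $l_k(x_{\sigma(1)},\ldots,x_{\sigma(k)})=\chi(\sigma)\,l_k(x_1,\ldots,x_k)$ for $\sigma\in\mathcal S_k$, and such that for all finite $n$ with $1\le n\le m$ $$\sum_{i+j=n+1}\sum_\sigma\chi(\sigma)(-1)^{i(j-1)}l_j(l_i(x_{\sigma(1)},\ldots,x_{\sigma(i)}),x_{\sigma(i+1)},\ldots,x_{\sigma(n)})=0,$$ where $i,j\ge1$ and $\sigma$ runs over all $(i,n-i)$-unshuffles. A morphism $(L,l_k)\to(L',l'_k)$ is a degree $0$ linear map $g$ with $g\circ l_k=l_k'\circ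 g^{\otimes k}$ for all $1\le k\le m$, $k<\infty$. The resulting category is $\mathbf L(m)$. *)

theory Defs
  imports
    "HOL-Combinatorics.Permutations"
    "HOL-Library.Poly_Mapping"
    "HOL-Library.Extended_Nat"
    "HOL-Algebra.Module"
begin

section \<open>Graded vector spaces\<close>

locale char_zero_field = field R for R (structure) +
  assumes char_zero: "\<And>n::nat. n > 0 \<Longrightarrow> [n] \<cdot> \<one> \<noteq> \<zero>"

text \<open>The fields \<open>mult\<close> and \<open>one\<close>, which \<^type>\<open>module\<close> inherits from the record of rings, play
  no role.\<close>

record ('k, 'v) graded_module = "('k, 'v) module" +
  component :: "int \<Rightarrow> 'v set"

locale graded_vector_space = field R + module R V
  for R (structure) and V :: "('k, 'v, 'x) graded_module_scheme" (structure) +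
  assumes component_submodule: "submodule (component V d) R V"
    and direct_sum: "v \<in> carrier V \<Longrightarrow>
      \<exists>!c. (\<forall>d. c d \<in> component V d) \<and> finite {d. c d \<noteq> \<zero>\<^bsub>V\<^esub>} \<and>
           v = (\<Oplus>\<^bsub>V\<^esub>d\<in>{d. c d \<noteq> \<zero>\<^bsub>V\<^esub>}. c d)"

definition homogeneous :: "('k, 'v, 'x) graded_module_scheme \<Rightarrow> int list \<Rightarrow> 'v list \<Rightarrow> bool" where
  "homogeneous V ds xs \<longleftrightarrow> list_all2 (\<lambda>d x. x \<in> component V d) ds xs"

text \<open>A linear map from the \<open>n\<close>-th tensor power of \<open>V\<close> to \<open>V\<close> is represented by the corresponding
  \<open>n\<close>-linear map; the list \<open>[v\<^sub>1, \<dots>, v\<^sub>n]\<close> stands for the elementary tensor of its entries.  Maps are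
  \<^const>\<open>undefined\<close> off their domain, so that equality of maps is equality in HOL.\<close>

definition tensors :: "('k, 'v, 'x) graded_module_scheme \<Rightarrow> nat \<Rightarrow> 'v list set" where
  "tensors V n = {xs. length xs = n \<and> set xs \<subseteq> carrier V}"

definition tensor_maps ::
  "('k, 'r) ring_scheme \<Rightarrow> ('k, 'v, 'x) graded_module_scheme \<Rightarrow> nat \<Rightarrow> int \<Rightarrow> ('v list \<Rightarrow> 'v) set" where
  "tensor_maps R V n p = {f \<in> tensors V n \<rightarrow>\<^sub>E carrier V.
     (\<forall>xs\<in>tensors V n. \<forall>i<n. \<forall>x\<in>carrier V. \<forall>y\<in>carrier V.
        f (xs[i := x \<oplus>\<^bsub>V\<^esub> y]) = f (xs[i := x]) \<oplus>\<^bsub>V\<^esub> f (xs[i := y])) \<and>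
     (\<forall>xs\<in>tensors V n. \<forall>i<n. \<forall>c\<in>carrier R. \<forall>x\<in>carrier V.
        f (xs[i := c \<odot>\<^bsub>V\<^esub> x]) = c \<odot>\<^bsub>V\<^esub> f (xs[i := x])) \<and>
     (\<forall>ds xs. length xs = n \<and> homogeneous V ds xs \<longrightarrow> f xs \<in> component V (sum_list ds + p))}"

definition graded_maps ::
  "('k, 'r) ring_scheme \<Rightarrow> ('k, 'v, 'x) graded_module_scheme \<Rightarrow> ('k, 'w, 'y) graded_module_scheme
     \<Rightarrow> ('v \<Rightarrow> 'w) set" where
  "graded_maps R V W = {f \<in> carrier V \<rightarrow>\<^sub>E carrier W.
     (\<forall>x\<in>carrier V. \<forall>y\<in>carrier V. f (x \<oplus>\<^bsub>V\<^esub> y) = f x \<oplus>\<^bsub>W\<^esub> f y) \<and>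
     (\<forall>c\<in>carrier R. \<forall>x\<in>carrier V. f (c \<odot>\<^bsub>V\<^esub> x) = c \<odot>\<^bsub>W\<^esub> f x) \<and>
     (\<forall>d. f ` component V d \<subseteq> component W d)}"


section \<open>Signs\<close>

definition msign :: "int \<Rightarrow> int" where
  "msign k = (if even k then 1 else -1)"

text \<open>The free graded commutative algebra on \<open>x\<^sub>0, \<dots>, x\<^bsub>n-1\<^esub>\<close> of degrees \<open>ds\<close> is the quotient of the
  noncommutative polynomials, with the word \<open>[i, j, \<dots>]\<close> standing for \<open>x\<^sub>i \<and> x\<^sub>j \<and> \<dots>\<close>, by the
  two-sided ideal generated by the graded commutators of the generators.  This ideal is spanned by
  the elements added in the second rule below.  Rational coefficients suffice for defining a
  sign.\<close>

inductive_set graded_commutator_ideal :: "int list \<Rightarrow> (nat list \<Rightarrow>\<^sub>0 rat) set" for ds where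
  zero: "0 \<in> graded_commutator_ideal ds"
| add: "p \<in> graded_commutator_ideal ds \<Longrightarrow> set (u @ [a, b] @ v) \<subseteq> {..<length ds} \<Longrightarrow>
    p + (Poly_Mapping.single (u @ [a, b] @ v) c
         - Poly_Mapping.single (u @ [b, a] @ v) (of_int (msign (ds ! a * ds ! b)) * c))
      \<in> graded_commutator_ideal ds"

text \<open>Permutations act on the positions \<open>0, \<dots>, n-1\<close>.  The monomials below are squarefree, so that
  exactly one of the two signs has the required property.\<close>

definition koszul_sign :: "int list \<Rightarrow> (nat \<Rightarrow> nat) \<Rightarrow> int" where
  "koszul_sign ds \<sigma> = (THE e. e \<in> {1, -1} \<and>
     Poly_Mapping.single [0..<length ds] 1 - Poly_Mapping.single (map \<sigma> [0..<length ds]) (of_int e)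
       \<in> graded_commutator_ideal ds)"

definition chi :: "int list \<Rightarrow> (nat \<Rightarrow> nat) \<Rightarrow> int" where
  "chi ds \<sigma> = sign \<sigma> * koszul_sign ds \<sigma>"

definition unshuffles :: "nat \<Rightarrow> nat \<Rightarrow> (nat \<Rightarrow> nat) set" where
  "unshuffles j n = {\<sigma>. \<sigma> permutes {..<n} \<and> strict_mono_on {..<j} \<sigma> \<and> strict_mono_on {j..<n} \<sigma>}"


section \<open>Structures up to order \<open>m\<close>\<close>

definition arity_range :: "enat \<Rightarrow> nat set" where
  "arity_range m = {k. 1 \<le> k \<and> enat k \<le> m}"

text \<open>Signs act through the integer multiples \<open>[s] \<cdot> v\<close> of the underlying abelian group.\<close>

locale A_structure = graded_vector_space R V
  for R (structure) and m :: enat and V :: "('k, 'v, 'x) graded_module_scheme" (structure)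
    and \<mu> :: "nat \<Rightarrow> 'v list \<Rightarrow> 'v" +
  assumes maps: "\<mu> \<in> (\<Pi>\<^sub>E k\<in>arity_range m. tensor_maps R V k (int k - 2))"
    and identity: "n \<in> arity_range m \<Longrightarrow> length xs = n \<Longrightarrow> homogeneous V ds xs \<Longrightarrow>
      (\<Oplus>\<^bsub>V\<^esub>l\<in>{0..n-1}. \<Oplus>\<^bsub>V\<^esub>k\<in>{1..n-l}.
         [msign (int k + int l + int k * int l + int n * int k + int k * sum_list (take l ds))] \<cdot>\<^bsub>V\<^esub>
           \<mu> (n - k + 1) (take l xs @ [\<mu> k (take k (drop l xs))] @ drop (l + k) xs)) = \<zero>\<^bsub>V\<^esub>"

locale L_structure = graded_vector_space R V
  for R (structure) and m :: enat and V :: "('k, 'v, 'x) graded_module_scheme" (structure)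
    and l :: "nat \<Rightarrow> 'v list \<Rightarrow> 'v" +
  assumes maps: "l \<in> (\<Pi>\<^sub>E k\<in>arity_range m. tensor_maps R V k (int k - 2))"
    and antisymmetric: "k \<in> arity_range m \<Longrightarrow> length xs = k \<Longrightarrow> homogeneous V ds xs \<Longrightarrow>
      \<sigma> permutes {..<k} \<Longrightarrow> l k (permute_list \<sigma> xs) = [chi ds \<sigma>] \<cdot>\<^bsub>V\<^esub> l k xs"
    and identity: "n \<in> arity_range m \<Longrightarrow> length xs = n \<Longrightarrow> homogeneous V ds xs \<Longrightarrow>
      finsum V (\<lambda>(i, j). \<Oplus>\<^bsub>V\<^esub>\<sigma>\<in>unshuffles i n.
          [(chi ds \<sigma> * msign (int i * (int j - 1)))] \<cdot>\<^bsub>V\<^esub>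
            l j (l i (take i (permute_list \<sigma> xs)) # drop i (permute_list \<sigma> xs)))
        {(i, j). 1 \<le> i \<and> 1 \<le> j \<and> i + j = n + 1} = \<zero>\<^bsub>V\<^esub>"

text \<open>The formula for \<open>l\<^sub>n\<close> involves degrees, hence prescribes its values on tensors of homogeneous
  elements only; \<open>l\<^sub>n\<close> is the linear map with these values.\<close>

definition antisymmetrization ::
  "('k, 'r) ring_scheme \<Rightarrow> enat \<Rightarrow> ('k, 'v, 'x) graded_module_scheme
     \<Rightarrow> (nat \<Rightarrow> 'v list \<Rightarrow> 'v) \<Rightarrow> nat \<Rightarrow> 'v list \<Rightarrow> 'v" where
  "antisymmetrization R m V \<mu> = (\<lambda>n\<in>arity_range m. THE f. f \<in> tensor_maps R V n (int n - 2) \<and>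
     (\<forall>ds xs. length xs = n \<and> homogeneous V ds xs \<longrightarrow>
        f xs = (\<Oplus>\<^bsub>V\<^esub>\<sigma>\<in>{\<sigma>. \<sigma> permutes {..<n}}. [chi ds \<sigma>] \<cdot>\<^bsub>V\<^esub> \<mu> n (permute_list \<sigma> xs))))"


section \<open>Categories and functors\<close>

record ('o, 'a) cat =
  Ob :: "'o set"
  Mor :: "'o \<Rightarrow> 'o \<Rightarrow> 'a set"
  Ident :: "'o \<Rightarrow> 'a"
  Comp :: "'o \<Rightarrow> 'o \<Rightarrow> 'o \<Rightarrow> 'a \<Rightarrow> 'a \<Rightarrow> 'a"

text \<open>\<open>Comp C X Y Z g f\<close> is the composite of \<open>f: X \<rightarrow> Y\<close> and \<open>g: Y \<rightarrow> Z\<close>.\<close>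

locale category =
  fixes C :: "('o, 'a) cat"
  assumes Ident_in: "X \<in> Ob C \<Longrightarrow> Ident C X \<in> Mor C X X"
    and Comp_in: "\<lbrakk>X \<in> Ob C; Y \<in> Ob C; Z \<in> Ob C; f \<in> Mor C X Y; g \<in> Mor C Y Z\<rbrakk>
      \<Longrightarrow> Comp C X Y Z g f \<in> Mor C X Z"
    and Comp_Ident_right: "\<lbrakk>X \<in> Ob C; Y \<in> Ob C; f \<in> Mor C X Y\<rbrakk> \<Longrightarrow> Comp C X X Y f (Ident C X) = f"
    and Comp_Ident_left: "\<lbrakk>X \<in> Ob C; Y \<in> Ob C; f \<in> Mor C X Y\<rbrakk> \<Longrightarrow> Comp C X Y Y (Ident C Y) f = f"
    and Comp_assoc: "\<lbrakk>W \<in> Ob C; X \<in> Ob C; Y \<in> Ob C; Z \<in> Ob C;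
        f \<in> Mor C W X; g \<in> Mor C X Y; h \<in> Mor C Y Z\<rbrakk>
      \<Longrightarrow> Comp C W Y Z h (Comp C W X Y g f) = Comp C W X Z (Comp C X Y Z h g) f"

locale cat_functor = source: category C + target: category D
  for C :: "('o, 'a) cat" and D :: "('p, 'b) cat"
    and F :: "'o \<Rightarrow> 'p" and \<Phi> :: "'o \<Rightarrow> 'o \<Rightarrow> 'a \<Rightarrow> 'b" +
  assumes F_Ob: "X \<in> Ob C \<Longrightarrow> F X \<in> Ob D"
    and F_Mor: "\<lbrakk>X \<in> Ob C; Y \<in> Ob C; f \<in> Mor C X Y\<rbrakk> \<Longrightarrow> \<Phi> X Y f \<in> Mor D (F X) (F Y)"
    and F_Ident: "X \<in> Ob C \<Longrightarrow> \<Phi> X X (Ident C X) = Ident D (F X)"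
    and F_Comp: "\<lbrakk>X \<in> Ob C; Y \<in> Ob C; Z \<in> Ob C; f \<in> Mor C X Y; g \<in> Mor C Y Z\<rbrakk>
      \<Longrightarrow> \<Phi> X Z (Comp C X Y Z g f) = Comp D (F X) (F Y) (F Z) (\<Phi> Y Z g) (\<Phi> X Y f)"

type_synonym ('k, 'v) graded_algebra = "('k, 'v) graded_module \<times> (nat \<Rightarrow> 'v list \<Rightarrow> 'v)"

definition algebra_morphisms ::
  "('k, 'r) ring_scheme \<Rightarrow> enat \<Rightarrow> ('k, 'v) graded_algebra \<Rightarrow> ('k, 'v) graded_algebra
     \<Rightarrow> ('v \<Rightarrow> 'v) set" where
  "algebra_morphisms R m X Y = {f \<in> graded_maps R (fst X) (fst Y).
     \<forall>n\<in>arity_range m. \<forall>xs\<in>tensors (fst X) n. f (snd X n xs) = snd Y n (map f xs)}"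

definition A_category ::
  "('k, 'r) ring_scheme \<Rightarrow> enat \<Rightarrow> (('k, 'v) graded_algebra, 'v \<Rightarrow> 'v) cat" where
  "A_category R m = \<lparr>
     Ob = {(V, \<mu>). A_structure R m V \<mu>},
     Mor = algebra_morphisms R m,
     Ident = (\<lambda>X. \<lambda>x\<in>carrier (fst X). x),
     Comp = (\<lambda>X Y Z g f. compose (carrier (fst X)) g f)\<rparr>"

definition L_category ::
  "('k, 'r) ring_scheme \<Rightarrow> enat \<Rightarrow> (('k, 'v) graded_algebra, 'v \<Rightarrow> 'v) cat" where
  "L_category R m = \<lparr>
     Ob = {(V, l). L_structure R m V l},
     Mor = algebra_morphisms R m,
     Ident = (\<lambda>X. \<lambda>x\<in>carrier (fst X). x),
     Comp = (\<lambda>X Y Z g f. compose (carrier (fst X)) g f)\<rparr>"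

end

theory Submission
  imports Defs "HOL-Combinatorics.Multiset_Permutations" "HOL-Algebra.AbelCoset"
begin

text \<open>Every sign is a product of factors attached to the inversions of a word in the labels of the
  arguments: \<open>\<chi>\<close> takes the factor \<open>-(-1)\<^bsup>pq\<^esup>\<close> for an inversion between labels of degrees \<open>p\<close>
  and \<open>q\<close>.  After expanding \<open>l\<^sub>j(l\<^sub>i(\<dots>), \<dots>)\<close>, the terms are indexed by an unshuffle (that is, a
  subset \<open>A\<close> of the labels), a word \<open>v\<close> in \<open>A\<close> and a word in the remaining labels together with a
  letter standing for the value of \<open>\<mu>\<^sub>i\<close>.  Substituting \<open>v\<close> for this letter gives a word
  \<open>\<rho> = u @ v @ w\<close> in all labels together with the position of the block \<open>v\<close>.  Moving the block past
  \<open>u\<close> produces exactly the sign in the identity of the \<open>A(m)\<close>-structure, so for fixed \<open>\<rho>\<close> the terms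
  add up to \<open>\<chi>(\<rho>)\<close> times that identity, evaluated at the arguments in the order \<open>\<rho>\<close>.\<close>

section \<open>Signs of words\<close>

text \<open>Two definite descriptions must be resolved before any computation:
  \<open>koszul_sign\<close> is defined by membership in an ideal, \<open>antisymmetrization\<close>
  by its values on homogeneous tensors. For the latter, existence comes from an explicit formula on
  even and odd parts, uniqueness from expanding every argument into homogeneous parts. Words replace
  permutations because the signs of a nested term belong to different symmetric groups: the
  unshuffle acts on all n labels, the inner permutation on the k labels in A, the outer one on n - k
  + 1 arguments. A sign read off from inversions needs only an ordered alphabet, so all three become
  signs of words in natural numbers. The letter for the inner value must be the least one, since
  that value stands first in l_j(l_i(...), ...); hence it is 0 and the other labels are shifted by
  \<open>Suc\<close>. Its degree is the total degree of the block plus k - 2, and this k produces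
  the summand k(|a_1| + ... + |a_l|) in the exponent of the A(m)-sign.\<close>

definition inversion_factor :: "(nat \<Rightarrow> nat \<Rightarrow> int) \<Rightarrow> nat \<Rightarrow> nat \<Rightarrow> int" where
  "inversion_factor c a b = (if b < a then c a b else 1)"

definition cross_sign :: "(nat \<Rightarrow> nat \<Rightarrow> int) \<Rightarrow> nat list \<Rightarrow> nat list \<Rightarrow> int" where
  "cross_sign c u v = (\<Prod>a\<leftarrow>u. \<Prod>b\<leftarrow>v. inversion_factor c a b)"

text \<open>The weight \<open>c\<close> is a parameter so that one set of rules serves three signs:
  c = -1 gives the sign of a permutation, c = (-1)^(pq) the Koszul sign, and the product of the two
  weights gives \<chi>.\<close>

primrec word_sign :: "(nat \<Rightarrow> nat \<Rightarrow> int) \<Rightarrow> nat list \<Rightarrow> int" where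
  "word_sign c [] = 1"
| "word_sign c (a # w) = cross_sign c [a] w * word_sign c w"

lemma prod_list_mult:
  fixes f g :: "'a \<Rightarrow> int"
  shows "(\<Prod>a\<leftarrow>u. f a * g a) = (\<Prod>a\<leftarrow>u. f a) * (\<Prod>a\<leftarrow>u. g a)"
  by (induction u) (auto simp: algebra_simps)

lemma prod_list_cong_mset:
  fixes f :: "'a \<Rightarrow> int"
  assumes "mset u = mset v"
  shows "(\<Prod>a\<leftarrow>u. f a) = (\<Prod>a\<leftarrow>v. f a)"
  using assms by (metis mset_map prod_mset_prod_list)

lemma cross_sign_Nil [simp]: "cross_sign c [] v = 1" "cross_sign c u [] = 1"
  by (auto simp: cross_sign_def map_replicate_const)

lemma cross_sign_append_left: "cross_sign c (u @ u') v = cross_sign c u v * cross_sign c u' v"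
  by (simp add: cross_sign_def)

lemma cross_sign_append_right: "cross_sign c u (v @ v') = cross_sign c u v * cross_sign c u v'"
  by (simp add: cross_sign_def prod_list_mult)

lemma cross_sign_Cons_left: "cross_sign c (a # u) v = cross_sign c [a] v * cross_sign c u v"
  by (simp add: cross_sign_def)

lemma cross_sign_cong_mset:
  assumes "mset u = mset u'" "mset v = mset v'"
  shows "cross_sign c u v = cross_sign c u' v'"
proof -
  have "(\<Prod>b\<leftarrow>v. inversion_factor c a b) = (\<Prod>b\<leftarrow>v'. inversion_factor c a b)" for a
    using assms(2) by (rule prod_list_cong_mset)
  then show ?thesis
    unfolding cross_sign_def by (simp add: prod_list_cong_mset[OF assms(1)])
qed

text \<open>An inversion of a concatenation lies inside \<open>u\<close>, inside \<open>v\<close>,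
  or between a letter of \<open>u\<close> and a smaller one of \<open>v\<close>. All block
  computations start from this splitting.\<close>

lemma word_sign_append: "word_sign c (u @ v) = word_sign c u * word_sign c v * cross_sign c u v"
proof (induction u)
  case (Cons a u)
  show ?case
    unfolding append_Cons word_sign.simps cross_sign_append_right Cons
      cross_sign_Cons_left[of c a u v] by (simp only: ac_simps)
qed simp

lemma word_sign_mult:
  "word_sign (\<lambda>a b. c a b * c' a b) w = word_sign c w * word_sign c' w"
proof (induction w)
  case (Cons a w)
  have "inversion_factor (\<lambda>a b. c a b * c' a b) a
      = (\<lambda>b. inversion_factor c a b * inversion_factor c' a b)"
    by (auto simp: inversion_factor_def)
  then have "cross_sign (\<lambda>a b. c a b * c' a b) [a] w = cross_sign c [a] w * cross_sign c' [a] w"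
    unfolding cross_sign_def by (simp only: list.map prod_list.Cons prod_list.Nil prod_list_mult mult_1_right)
  then show ?case
    unfolding word_sign.simps Cons by (simp only: ac_simps)
qed simp

text \<open>Inversions depend only on the order of the letters, so a monotone relabelling merely
  transports the weight. This carries signs from positions to labels and makes the shift by
  \<open>Suc\<close> harmless.\<close>

lemma word_sign_map:
  assumes "strict_mono_on (set w) f"
  shows "word_sign c (map f w) = word_sign (\<lambda>a b. c (f a) (f b)) w"
  using assms
proof (induction w)
  case (Cons a w)
  have "inversion_factor c (f a) (f b) = inversion_factor (\<lambda>a b. c (f a) (f b)) a b"
    if "b \<in> set w" for b
    using strict_mono_on_less[OF Cons.prems, of b a] that by (auto simp: inversion_factor_def)
  then have "cross_sign c [f a] (map f w) = cross_sign (\<lambda>a b. c (f a) (f b)) [a] w"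
    by (simp add: cross_sign_def o_def cong: map_cong)
  moreover have "strict_mono_on (set w) f"
    using Cons.prems by (auto simp: strict_mono_on_def)
  ultimately show ?case
    using Cons.IH by simp
qed simp

lemma word_sign_cong:
  assumes "\<And>a b. a \<in> set w \<Longrightarrow> b \<in> set w \<Longrightarrow> c a b = c' a b"
  shows "word_sign c w = word_sign c' w"
  using assms
proof (induction w)
  case (Cons a w)
  then have "inversion_factor c a b = inversion_factor c' a b" if "b \<in> set w" for b
    using that by (simp add: inversion_factor_def)
  then have "cross_sign c [a] w = cross_sign c' [a] w"
    by (simp add: cross_sign_def cong: map_cong)
  with Cons show ?case by simp
qed simp

lemma cross_sign_eq_1:
  assumes "\<And>a b. a \<in> set u \<Longrightarrow> b \<in> set v \<Longrightarrow> a \<le> b"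
  shows "cross_sign c u v = 1"
proof -
  have "inversion_factor c a b = 1" if "a \<in> set u" "b \<in> set v" for a b
    using assms[OF that] by (simp add: inversion_factor_def)
  then have "cross_sign c u v = (\<Prod>a\<leftarrow>u. \<Prod>b\<leftarrow>v. 1)"
    unfolding cross_sign_def by (intro arg_cong[of _ _ prod_list] map_cong refl)
  then show ?thesis
    by (simp add: map_replicate_const)
qed

lemma word_sign_sorted: "sorted w \<Longrightarrow> word_sign c w = 1"
proof (induction w)
  case (Cons a w)
  then show ?case
    using cross_sign_eq_1[of "[a]" w c] by simp
qed simp

text \<open>Only the pair of \<open>a\<close> and \<open>b\<close> changes its order, and it is
  inverted in exactly one of the two words. Symmetry and c^2 = 1 make the formula the same whichever
  word that is.\<close>

lemma word_sign_swap:
  assumes sym: "c b a = c a b" and sq: "c a b * c a b = 1" and ne: "a \<noteq> b"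
  shows "word_sign c (u @ [a, b] @ v) = c a b * word_sign c (u @ [b, a] @ v)"
proof -
  have ab: "word_sign c [a, b] = c a b * word_sign c [b, a]"
    using assms by (auto simp: cross_sign_def inversion_factor_def)
  have "cross_sign c u ([a, b] @ v) = cross_sign c u ([b, a] @ v)"
    and "cross_sign c [a, b] v = cross_sign c [b, a] v"
    by (rule cross_sign_cong_mset; simp)+
  note swap = ab this
  show ?thesis
    unfolding word_sign_append swap by (simp only: ac_simps)
qed

lemma word_sign_cases:
  assumes "\<And>a b. c a b \<in> {1, -1}"
  shows "word_sign c w \<in> {1, -1}"
proof -
  have inv: "inversion_factor c a b \<in> {1, -1}" for a b
    using assms by (auto simp: inversion_factor_def)
  have "(\<Prod>b\<leftarrow>v. inversion_factor c a b) \<in> {1, -1}" for a v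
  proof (induction v)
    case (Cons b v)
    then show ?case using inv[of a b] by auto
  qed simp
  then have "cross_sign c [a] v \<in> {1, -1}" for a v
    unfolding cross_sign_def by simp
  then show ?thesis
  proof (induction w)
    case (Cons a w)
    then show ?case by (metis (no_types, opaque_lifting) insert_iff minus_minus mult.commute
        mult_1 mult_minus1 singletonD word_sign.simps(2))
  qed simp
qed

section \<open>Induction along adjacent transpositions, and the two classical signs as signs of
  words\<close>

inductive adjacent_swap :: "'a list \<Rightarrow> 'a list \<Rightarrow> bool" where
  "adjacent_swap (u @ [a, b] @ v) (u @ [b, a] @ v)"

lemma adjacent_swaps_Cons:
  "adjacent_swap\<^sup>*\<^sup>* u v \<Longrightarrow> adjacent_swap\<^sup>*\<^sup>* (c # u) (c # v)"
proof (induction rule: rtranclp_induct)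
  case (step v w)
  then have "adjacent_swap (c # v) (c # w)"
    by (metis adjacent_swap.simps append_Cons)
  with step.IH show ?case by simp
qed simp

lemma adjacent_swaps_front: "adjacent_swap\<^sup>*\<^sup>* (a # p @ q) (p @ a # q)"
proof (induction p)
  case (Cons c p)
  have "adjacent_swap (a # c # p @ q) (c # a # p @ q)"
    using adjacent_swap.intros[of "[]" a c "p @ q"] by simp
  moreover have "adjacent_swap\<^sup>*\<^sup>* (c # a # p @ q) (c # p @ a # q)"
    using Cons by (rule adjacent_swaps_Cons)
  ultimately show ?case by simp
qed simp

lemma adjacent_swaps_if_mset_eq: "mset u = mset v \<Longrightarrow> adjacent_swap\<^sup>*\<^sup>* u v"
proof (induction u arbitrary: v)
  case (Cons a u)
  then have "a \<in> set v"
    by (metis list.set_intros(1) set_mset_mset)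
  then obtain p q where v: "v = p @ a # q"
    by (meson split_list)
  with Cons have "adjacent_swap\<^sup>*\<^sup>* (a # u) (a # p @ q)"
    by (intro adjacent_swaps_Cons Cons.IH) simp
  with adjacent_swaps_front[of a p q] show ?case
    unfolding v by simp
qed simp

text \<open>Stands in for the generation of the symmetric group by adjacent transpositions. The
  multiset hypothesis of the swap case carries distinctness and the set of letters through the
  induction, so that \<open>P\<close> can be stated without them.\<close>

lemma adjacent_swap_induct [consumes 1, case_names start swap]:
  assumes "mset w = mset w0" and "P w0"
    and "\<And>u a b v. mset (u @ [a, b] @ v) = mset w0 \<Longrightarrow> P (u @ [a, b] @ v) \<Longrightarrow> P (u @ [b, a] @ v)"
  shows "P w"
proof -
  have "adjacent_swap\<^sup>*\<^sup>* w0 w"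
    using assms(1) by (intro adjacent_swaps_if_mset_eq) simp
  then have "P w \<and> mset w = mset w0"
  proof (induction rule: rtranclp_induct)
    case (step v w)
    from step(2) show ?case
      using step(3) assms(3) by cases (auto simp: add_mset_commute)
  qed (use assms in auto)
  then show ?thesis ..
qed

lemma msign_cases: "msign k \<in> {1, -1}"
  by (simp add: msign_def)

lemma msign_sq [simp]: "msign k * msign k = 1"
  by (simp add: msign_def)

lemma msign_add: "msign (k + l) = msign k * msign l"
  by (auto simp: msign_def)

lemma msign_0 [simp]: "msign 0 = 1"
  by (simp add: msign_def)

lemma msign_cong: "even (k - l) \<Longrightarrow> msign k = msign l"
  by (auto simp: msign_def)

lemma permutes_lessThan_mset:
  assumes "\<sigma> permutes {..<n}"
  shows "mset (map \<sigma> [0..<n]) = mset [0..<n]"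
proof -
  have "distinct (map \<sigma> [0..<n])"
    using permutes_inj_on[OF assms] by (simp add: distinct_map)
  moreover have "set (map \<sigma> [0..<n]) = set [0..<n]"
    using permutes_image[OF assms] by (simp add: lessThan_atLeast0)
  ultimately show ?thesis
    by (metis distinct_upt set_eq_iff_mset_eq_distinct)
qed

text \<open>Exchanging neighbouring letters of the word composes the permutation on the right with a
  transposition of positions, and both sides change sign.\<close>

lemma sign_eq_word_sign:
  assumes "\<sigma> permutes {..<n}"
  shows "sign \<sigma> = word_sign (\<lambda>_ _. -1) (map \<sigma> [0..<n])"
proof -
  \<comment> \<open>Quantifying over every permutation with word \<open>w\<close> turns a claim
    about permutations into a predicate on words, to which the swap induction applies.\<close>
  define P where "P w \<longleftrightarrow> (\<forall>\<sigma>. \<sigma> permutes {..<n} \<and> map \<sigma> [0..<n] = w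
    \<longrightarrow> sign \<sigma> = word_sign (\<lambda>_ _. -1) w)" for w
  have "P w" if "mset w = mset [0..<n]" for w
    using that
  proof (induction w rule: adjacent_swap_induct)
    case start
    have "\<tau> = id" if "\<tau> permutes {..<n}" "map \<tau> [0..<n] = [0..<n]" for \<tau>
    proof
      fix i show "\<tau> i = id i"
        using that permutes_not_in[OF that(1), of i] 
        by (cases "i < n") (auto simp: list_eq_iff_nth_eq)
    qed
    then show ?case
      unfolding P_def by (metis sign_id sorted_upt word_sign_sorted)
  next
    case (swap u a b v)
    have dist: "distinct (u @ [a, b] @ v)"
      using swap(1) by (metis distinct_upt mset_eq_imp_distinct_iff)
    have len: "length u + 2 + length v = n"
      using arg_cong[OF swap(1), of size] by simp
    show ?case
      unfolding P_def
    proof safe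
      fix \<tau> assume \<tau>: "\<tau> permutes {..<n}" "map \<tau> [0..<n] = u @ [b, a] @ v"
      let ?i = "length u"
      let ?t = "transpose ?i (Suc ?i)"
      have nth: "\<tau> k = (u @ [b, a] @ v) ! k" if "k < n" for k
        using arg_cong[OF \<tau>(2), of "\<lambda>w. w ! k"] that by simp
      have t: "?t permutes {..<n}"
        using len by (intro permutes_swap_id) auto
      have "map (\<tau> \<circ> ?t) [0..<n] = u @ [a, b] @ v"
      proof (rule nth_equalityI)
        fix k assume "k < length (map (\<tau> \<circ> ?t) [0..<n])"
        then have k: "k < n" by simp
        then have "?t k < n"
          using permutes_in_image[OF t, of k] by simp
        then show "map (\<tau> \<circ> ?t) [0..<n] ! k = (u @ [a, b] @ v) ! k"
          using k by (auto simp: nth nth_append nth_Cons' transpose_def)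
      qed (use len in simp)
      with swap(2) t \<tau>(1) have "sign (\<tau> \<circ> ?t) = word_sign (\<lambda>_ _. -1) (u @ [a, b] @ v)"
        unfolding P_def by (meson permutes_compose)
      moreover have "sign (\<tau> \<circ> ?t) = - sign \<tau>"
        using t \<tau>(1) by (subst sign_compose) (auto simp: sign_swap_id permutes_imp_permutation[of "{..<n}"])
      moreover have "word_sign (\<lambda>_ _. -1) (u @ [a, b] @ v) = -1 * word_sign (\<lambda>_ _. -1) (u @ [b, a] @ v)"
        using dist by (intro word_sign_swap) auto
      ultimately show "sign \<tau> = word_sign (\<lambda>_ _. -1) (u @ [b, a] @ v)"
        by simp
    qed
  qed
  then show ?thesis
    using assms permutes_lessThan_mset[OF assms] unfolding P_def by blast
qed

text \<open>The linear functional \<open>\<phi>\<close> of the proof sends a squarefree word to the sign of sorting it.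
  It kills the ideal, which determines the sign in the definition of \<^const>\<open>koszul_sign\<close>.\<close>

lemma koszul_sign_eq_word_sign:
  assumes "\<sigma> permutes {..<length ds}"
  shows "koszul_sign ds \<sigma>
    = word_sign (\<lambda>a b. msign (ds ! a * ds ! b)) (map \<sigma> [0..<length ds])"
proof -
  define n where "n = length ds"
  define c where "c = (\<lambda>a b. msign (ds ! a * ds ! b))"
  define w where "w = map \<sigma> [0..<n]"
  define S where "S = {w. set w \<subseteq> {..<n} \<and> distinct w}"
  define \<phi> :: "(nat list \<Rightarrow>\<^sub>0 rat) \<Rightarrow> rat"
    where "\<phi> p = (\<Sum>w\<in>S. Poly_Mapping.lookup p w * of_int (word_sign c w))" for p
  have c: "c a b \<in> {1, -1}" "c a b * c a b = 1" "c b a = c a b" for a b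
    using msign_cases by (auto simp: c_def mult.commute)
  have ws: "word_sign c w \<in> {1, -1}" for w
    using c(1) by (rule word_sign_cases)
  have fin: "finite S"
    unfolding S_def by (rule finite_subset_distinct) simp
  have \<phi>_add: "\<phi> (p + q) = \<phi> p + \<phi> q" and \<phi>_diff: "\<phi> (p - q) = \<phi> p - \<phi> q" for p q
    by (simp_all add: \<phi>_def lookup_add lookup_minus sum.distrib sum_subtractf algebra_simps)
  have \<phi>_single: "\<phi> (Poly_Mapping.single w r) = (if w \<in> S then r * of_int (word_sign c w) else 0)" for w r
  proof -
    have "\<phi> (Poly_Mapping.single w r) = (\<Sum>v\<in>S. if v = w then r * of_int (word_sign c w) else 0)"
      unfolding \<phi>_def by (rule sum.cong) (auto simp: lookup_single when_def)
    then show ?thesis using fin by simp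
  qed
  have \<phi>_ideal: "\<phi> p = 0" if "p \<in> graded_commutator_ideal ds" for p
    using that
  proof induction
    case zero
    then show ?case by (simp add: \<phi>_def)
  next
    case (add p u a b v r)
    have iff: "u @ [a, b] @ v \<in> S \<longleftrightarrow> u @ [b, a] @ v \<in> S"
      by (auto simp: S_def)
    have "word_sign c (u @ [a, b] @ v) = c a b * word_sign c (u @ [b, a] @ v)"
      if "u @ [a, b] @ v \<in> S"
      using that c by (intro word_sign_swap) (auto simp: S_def)
    then show ?case
      using add iff by (simp add: \<phi>_add \<phi>_diff \<phi>_single c_def del: append.simps)
  qed
  have mset: "mset w = mset [0..<n]"
    unfolding w_def n_def using assms by (rule permutes_lessThan_mset)
  have "w \<in> S" "[0..<n] \<in> S"
    using mset_eq_imp_distinct_iff[OF mset] mset_eq_setD[OF mset] by (auto simp: S_def)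
  then have unique: "e = word_sign c w" if "e \<in> {1, -1}"
    and "Poly_Mapping.single [0..<n] 1 - Poly_Mapping.single w (of_int e) \<in> graded_commutator_ideal ds" for e
    using \<phi>_ideal[OF that(2)] that(1) ws[of w] by (auto simp: \<phi>_diff \<phi>_single word_sign_sorted)
  have "Poly_Mapping.single [0..<n] 1 - Poly_Mapping.single w (of_int (word_sign c w)) \<in> graded_commutator_ideal ds"
    using mset
  proof (induction w rule: adjacent_swap_induct)
    case start
    then show ?case
      by (simp add: word_sign_sorted graded_commutator_ideal.zero)
  next
    case (swap u a b v)
    have "distinct (u @ [a, b] @ v)"
      using swap(1) by (metis distinct_upt mset_eq_imp_distinct_iff)
    then have eq: "word_sign c (u @ [b, a] @ v) = c a b * word_sign c (u @ [a, b] @ v)"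
      using word_sign_swap[of c a b u v] c by auto
    have "set (u @ [a, b] @ v) \<subseteq> {..<length ds}"
      using mset_eq_setD[OF swap(1)] by (simp add: n_def lessThan_atLeast0)
    \<comment> \<open>The generator is scaled by the sign accumulated so far: its first monomial
      cancels the current word, and its second introduces the swapped word with the updated
      sign.\<close>
    from graded_commutator_ideal.add[OF swap(2) this, of "of_int (word_sign c (u @ [a, b] @ v))"]
    show ?case
      by (simp add: eq[simplified] flip: c_def[THEN fun_cong, THEN fun_cong])
  qed
  with unique ws have "koszul_sign ds \<sigma> = word_sign c w"
    unfolding koszul_sign_def n_def w_def by (intro the_equality) blast+
  then show ?thesis
    by (simp add: c_def w_def n_def)
qed

section \<open>The sign \<chi> under composition and under moves of blocks\<close>

abbreviation chi_word :: "(nat \<Rightarrow> int) \<Rightarrow> nat list \<Rightarrow> int" where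
  "chi_word d \<equiv> word_sign (\<lambda>a b. - msign (d a * d b))"

lemma chi_eq_chi_word:
  assumes "\<sigma> permutes {..<length ds}"
  shows "chi ds \<sigma> = chi_word (nth ds) (map \<sigma> [0..<length ds])"
  using word_sign_mult[of "\<lambda>_ _. -1" "\<lambda>a b. msign (ds ! a * ds ! b)" "map \<sigma> [0..<length ds]"]
  unfolding chi_def sign_eq_word_sign[OF assms] koszul_sign_eq_word_sign[OF assms] by simp

lemma chi_word_cases: "chi_word d w \<in> {1, -1}"
  by (rule word_sign_cases) (use msign_cases in auto)

lemma chi_word_swap:
  assumes "a \<noteq> b"
  shows "chi_word d (u @ [a, b] @ v) = - msign (d a * d b) * chi_word d (u @ [b, a] @ v)"
  using assms by (intro word_sign_swap) (auto simp: mult.commute)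

text \<open>The cocycle rule for \<chi>, with \<open>w\<close> in the role of the second
  permutation. It is trivial for sorted \<open>w\<close>, and a swap of \<open>a\<close> and
  \<open>b\<close> multiplies both sides by the same factor, because
  \<open>d \<circ> \<sigma>\<close> assigns to \<open>a\<close> and \<open>b\<close> the degrees of
  \<sigma> a and \<sigma> b. The last factor is the price for a relabelling that is not
  monotone.\<close>

lemma chi_word_relabel:
  assumes "inj_on \<sigma> {..<n}" and "mset w = mset [0..<n]"
  shows "chi_word d (map \<sigma> w) = chi_word (d \<circ> \<sigma>) w * chi_word d (map \<sigma> [0..<n])"
  using assms(2)
proof (induction w rule: adjacent_swap_induct)
  case start
  then show ?case by (simp add: word_sign_sorted)
next
  case (swap u a b v)
  have "distinct (u @ [a, b] @ v)" "set (u @ [a, b] @ v) = {..<n}"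
    using swap(1) by (metis distinct_upt mset_eq_imp_distinct_iff)
      (use mset_eq_setD[OF swap(1)] in \<open>simp add: lessThan_atLeast0\<close>)
  then have "a \<noteq> b" "\<sigma> a \<noteq> \<sigma> b"
    using assms(1) by (auto simp: inj_on_def)
  then show ?case
    using swap(2) chi_word_swap[of b a "d \<circ> \<sigma>" u v]
      chi_word_swap[of "\<sigma> b" "\<sigma> a" d "map \<sigma> u" "map \<sigma> v"]
    by simp
qed

text \<open>The second sign takes permuted degrees because \<tau> acts on arguments that \<sigma>
  has already rearranged.\<close>

lemma chi_compose:
  assumes \<sigma>: "\<sigma> permutes {..<length ds}" and \<tau>: "\<tau> permutes {..<length ds}"
  shows "chi ds (\<sigma> \<circ> \<tau>) = chi ds \<sigma> * chi (permute_list \<sigma> ds) \<tau>"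
proof -
  let ?n = "length ds"
  have "chi ds (\<sigma> \<circ> \<tau>) = chi_word (nth ds) (map \<sigma> (map \<tau> [0..<?n]))"
    using chi_eq_chi_word[OF permutes_compose[OF \<tau> \<sigma>]] by simp
  also have "\<dots> = chi_word (nth ds \<circ> \<sigma>) (map \<tau> [0..<?n]) * chi_word (nth ds) (map \<sigma> [0..<?n])"
    using permutes_inj_on[OF \<sigma>] permutes_lessThan_mset[OF \<tau>] by (rule chi_word_relabel)
  also have "chi_word (nth ds \<circ> \<sigma>) (map \<tau> [0..<?n])
    = chi_word (nth (permute_list \<sigma> ds)) (map \<tau> [0..<?n])"
  proof (rule word_sign_cong)
    fix a b assume "a \<in> set (map \<tau> [0..<?n])" "b \<in> set (map \<tau> [0..<?n])"
    then have "a \<in> {..<?n}" "b \<in> {..<?n}"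
      using permutes_image[OF \<tau>] by (auto simp: lessThan_atLeast0)
    then show "- msign ((nth ds \<circ> \<sigma>) a * (nth ds \<circ> \<sigma>) b)
        = - msign (permute_list \<sigma> ds ! a * permute_list \<sigma> ds ! b)"
      using \<sigma> by (simp add: permute_list_nth)
  qed
  finally show ?thesis
    using chi_eq_chi_word[OF \<sigma>] chi_eq_chi_word[of \<tau> "permute_list \<sigma> ds"] \<tau> by (simp add: mult.commute o_def)
qed

abbreviation cross_chi :: "(nat \<Rightarrow> int) \<Rightarrow> nat list \<Rightarrow> nat list \<Rightarrow> int" where
  "cross_chi d \<equiv> cross_sign (\<lambda>a b. - msign (d a * d b))"

text \<open>With disjoint letters every pair is inverted in exactly one of the two orders, so the
  exchange contributes -(-1)^(pq) for each pair. Over all pairs the exponents add up to the product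
  of the lengths plus the product of the total degrees.\<close>

lemma cross_chi_commute:
  assumes "set u \<inter> set v = {}"
  shows "cross_chi d u v = cross_chi d v u
    * msign (int (length u) * int (length v) + sum_list (map d u) * sum_list (map d v))"
proof -
  have single: "cross_chi d [a] v = cross_chi d v [a] * msign (int (length v) + d a * sum_list (map d v))"
    if "a \<notin> set v" for a v
    using that
  proof (induction v)
    case (Cons b v)
    have "inversion_factor (\<lambda>a b. - msign (d a * d b)) a b
        = inversion_factor (\<lambda>a b. - msign (d a * d b)) b a * msign (1 + d a * d b)"
      using Cons.prems by (auto simp: inversion_factor_def msign_def)
    with Cons show ?case
      by (simp add: cross_sign_def distrib_left msign_add)
  qed (simp add: cross_sign_def)
  show ?thesis
    using assms
  proof (induction u)
    case (Cons a u)
    have "cross_chi d (a # u) v = cross_chi d [a] v * cross_chi d u v"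
      by (rule cross_sign_Cons_left)
    also have "cross_chi d [a] v
        = cross_chi d v [a] * msign (int (length v) + d a * sum_list (map d v))"
      using Cons.prems by (intro single) auto
    also have "cross_chi d u v = cross_chi d v u
        * msign (int (length u) * int (length v) + sum_list (map d u) * sum_list (map d v))"
      using Cons by auto
    finally show ?case
      using cross_sign_append_right[of "\<lambda>a b. - msign (d a * d b)" v "[a]" u]
      by (simp add: distrib_right msign_add)
  qed simp
qed

text \<open>The letter 0 is below all others, so it is inverted exactly with the letters of
  \<open>u\<close> on its left, each giving -(-1)^(e d(a)). \<open>case_nat e d\<close> gives 0 the
  degree \<open>e\<close> and lets each shifted label keep its own.\<close>

lemma chi_word_insert:
  "chi_word (case_nat e d) (map Suc u @ 0 # map Suc v)
    = chi_word d (u @ v) * msign (int (length u) + e * sum_list (map d u))"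
proof -
  let ?c = "\<lambda>a b. - msign (case_nat e d a * case_nat e d b)"
  have word: "word_sign ?c (map Suc w) = chi_word d w" for w
    by (subst word_sign_map) (auto intro: strict_mono_onI)
  have cross: "cross_sign ?c (map Suc u) (map Suc v) = cross_chi d u v"
    by (simp add: cross_sign_def inversion_factor_def o_def cong: if_cong)
  have zero: "cross_sign ?c [0] (map Suc v) = 1"
    by (rule cross_sign_eq_1) auto
  have u0: "cross_sign ?c (map Suc u) [0] = msign (int (length u) + e * sum_list (map d u))"
    by (induction u) (auto simp: cross_sign_def inversion_factor_def distrib_left msign_add msign_def)
  have u0v: "cross_sign ?c (map Suc u) (0 # map Suc v)
      = cross_sign ?c (map Suc u) [0] * cross_sign ?c (map Suc u) (map Suc v)"
    using cross_sign_append_right[of ?c "map Suc u" "[0]" "map Suc v"] by simp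
  show ?thesis
    unfolding word_sign_append word_sign.simps u0v zero u0 word cross by (simp only: ac_simps mult_1_left)
qed

text \<open>Moving the block \<open>v\<close> in front of \<open>u\<close> and treating it as a single argument of degree \<open>e\<close>
  accounts for the signs in the identities of an \<open>A(m)\<close>-structure.\<close>

lemma chi_word_block:
  assumes disj: "set u \<inter> set v = {}"
    and A: "mset s = mset v" "sorted s" and B: "mset t = mset (u @ w)" "sorted t"
    and k: "k = length v" and n: "n = length (u @ v @ w)"
    and e: "e = sum_list (map d v) + int k - 2"
  shows "chi_word d (s @ t) * msign (int k * (int (n - k + 1) - 1)) * chi_word d v
      * chi_word (case_nat e d) (map Suc u @ 0 # map Suc w)
    = chi_word d (u @ v @ w) * msign (int k + int (length u) + int k * int (length u)
      + int n * int k + int k * sum_list (map d u))"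
proof -
  let ?l = "int (length u)" and ?\<Sigma>u = "sum_list (map d u)" and ?\<Sigma>v = "sum_list (map d v)"
  \<comment> \<open>The sorted words \<open>s\<close> and \<open>t\<close> have no inversions of
    their own; only pairs of a letter in the block and a letter outside it count.\<close>
  have "chi_word d (s @ t) = cross_chi d v (u @ w)"
    using cross_sign_cong_mset[OF A(1) B(1)] A(2) B(2) by (simp add: word_sign_append word_sign_sorted)
  also have "\<dots> = cross_chi d u v * cross_chi d v w * msign (int k * ?l + ?\<Sigma>v * ?\<Sigma>u)"
    using cross_chi_commute[of v u d] disj k by (auto simp: cross_sign_append_right)
  finally have st: "chi_word d (s @ t) = \<dots>" .
  have uvw: "chi_word d (u @ v @ w) = chi_word d (u @ w) * chi_word d v * cross_chi d u v * cross_chi d v w"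
    by (simp add: word_sign_append cross_sign_append_right cross_sign_append_left)
  have "msign (int k * ?l + ?\<Sigma>v * ?\<Sigma>u) * msign (int k * (int (n - k + 1) - 1))
      * msign (?l + e * ?\<Sigma>u)
    = msign (int k * ?l + ?\<Sigma>v * ?\<Sigma>u + int k * (int (n - k + 1) - 1) + (?l + e * ?\<Sigma>u))"
    by (simp only: msign_add)
  \<comment> \<open>Modulo 2, \<open>e\<close> is \<Sigma>v + k and k^2 is k. The two products of
    \<Sigma>v and \<Sigma>u cancel and leave k \<Sigma>u, while k(n - k) becomes nk + k.\<close>
  also have "\<dots> = msign (int k + ?l + int k * ?l + int n * int k + int k * ?\<Sigma>u)"
    by (rule msign_cong) (use k n in \<open>auto simp: e algebra_simps\<close>)
  finally have signs: "\<dots> = msign (int k * ?l + ?\<Sigma>v * ?\<Sigma>u) * msign (int k * (int (n - k + 1) - 1))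
      * msign (?l + e * ?\<Sigma>u)" ..
  show ?thesis
    unfolding st uvw chi_word_insert signs by (simp only: ac_simps)
qed


section \<open>Sums in abelian groups\<close>

lemma (in abelian_monoid) finsum_reindex_bij:
  assumes "bij_betw h A B" "\<And>b. b \<in> B \<Longrightarrow> g b \<in> carrier G" "\<And>a. a \<in> A \<Longrightarrow> f a = g (h a)"
  shows "finsum G f A = finsum G g B"
proof -
  have "finsum G f A = (\<Oplus>a\<in>A. g (h a))"
    using assms by (intro finsum_cong') (auto simp: bij_betw_def)
  also have "\<dots> = finsum G g (h ` A)"
    using assms by (intro finsum_reindex[symmetric]) (auto simp: bij_betw_def)
  finally show ?thesis
    using assms(1) by (simp add: bij_betw_def)
qed

lemma (in abelian_monoid) finsum_Sigma:
  assumes "finite A" "\<And>a. a \<in> A \<Longrightarrow> finite (B a)"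
    and "\<And>a b. a \<in> A \<Longrightarrow> b \<in> B a \<Longrightarrow> f a b \<in> carrier G"
  shows "(\<Oplus>a\<in>A. \<Oplus>b\<in>B a. f a b) = finsum G (\<lambda>(a, b). f a b) (Sigma A B)"
  using assms
proof (induction A)
  case (insert a A)
  have "finsum G (\<lambda>(a, b). f a b) (Sigma (insert a A) B)
      = finsum G (\<lambda>(a, b). f a b) (Pair a ` B a \<union> Sigma A B)"
    by (rule arg_cong[where f = "finsum G _"]) auto
  also have "\<dots> = finsum G (\<lambda>(a, b). f a b) (Pair a ` B a) \<oplus> finsum G (\<lambda>(a, b). f a b) (Sigma A B)"
    using insert by (intro finsum_Un_disjoint) auto
  also have "finsum G (\<lambda>(a, b). f a b) (Pair a ` B a) = (\<Oplus>b\<in>B a. f a b)"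
    using insert.prems by (subst finsum_reindex) (auto simp: inj_on_def)
  finally show ?case
    using insert by (simp add: Pi_def)
qed simp

lemma (in abelian_monoid) finsum_swap:
  assumes "finite A" "finite B" "\<And>a b. a \<in> A \<Longrightarrow> b \<in> B \<Longrightarrow> f a b \<in> carrier G"
  shows "(\<Oplus>a\<in>A. \<Oplus>b\<in>B. f a b) = (\<Oplus>b\<in>B. \<Oplus>a\<in>A. f a b)"
proof -
  have "finsum G (\<lambda>(a, b). f a b) (A \<times> B) = finsum G (\<lambda>(b, a). f a b) (B \<times> A)"
    using assms by (intro finsum_reindex_bij[of prod.swap]) (auto simp: bij_betw_def)
  then show ?thesis
    using finsum_Sigma[of A "\<lambda>_. B" f] finsum_Sigma[of B "\<lambda>_. A" "\<lambda>b a. f a b"] assms by simp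
qed

lemma (in abelian_group_hom) hom_finsum:
  assumes "f \<in> A \<rightarrow> carrier G"
  shows "h (finsum G f A) = (\<Oplus>\<^bsub>H\<^esub>a\<in>A. h (f a))"
proof (cases "finite A")
  case True
  then show ?thesis
    using assms by (induction A) (auto simp: Pi_def)
qed simp

lemma (in abelian_group_hom) hom_add_pow_int:
  assumes "x \<in> carrier G"
  shows "h ([(s::int)] \<cdot>\<^bsub>G\<^esub> x) = [s] \<cdot>\<^bsub>H\<^esub> h x"
  using group_hom.hom_int_pow[OF a_group_hom, of x s] assms by (simp add: add_pow_def)

lemma (in abelian_group) abelian_group_hom_into:
  assumes "abelian_group H" "\<And>x. x \<in> carrier G \<Longrightarrow> h x \<in> carrier H"
    "\<And>x y. x \<in> carrier G \<Longrightarrow> y \<in> carrier G \<Longrightarrow> h (x \<oplus> y) = h x \<oplus>\<^bsub>H\<^esub> h y"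
  shows "abelian_group_hom G H h"
  using assms
  by (intro abelian_group_homI abelian_group_axioms group_hom.intro group_hom_axioms.intro)
    (auto simp: hom_def abelian_group.a_group)

lemma (in abelian_group) add_pow_finsum:
  assumes "f \<in> A \<rightarrow> carrier G"
  shows "[(s::int)] \<cdot> finsum G f A = (\<Oplus>a\<in>A. [s] \<cdot> f a)"
proof -
  interpret abelian_group_hom G G "\<lambda>x. [s] \<cdot> x"
    by (rule abelian_group_hom_into) (auto simp: abelian_group_axioms add.int_pow_distrib)
  show ?thesis using assms by (rule hom_finsum)
qed

lemma (in abelian_group) add_pow_mult:
  "x \<in> carrier G \<Longrightarrow> [(s * t::int)] \<cdot> x = [s] \<cdot> ([t] \<cdot> x)"
  by (simp add: add.int_pow_pow mult.commute)

section \<open>Multilinear maps on graded vector spaces\<close>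

text \<open>Keeps closure and additivity in each slot, with separate source and target and no
  restriction off the domain. Thus it covers both sides of the equation for a morphism
  \<open>f\<close>, namely \<open>f\<close> after a bracket and a bracket after
  \<open>map f\<close>, which take tensors over one space to values in another.\<close>

definition multiadditive ::
  "('a, 'm) ring_scheme \<Rightarrow> ('b, 'n) ring_scheme \<Rightarrow> nat \<Rightarrow> ('a list \<Rightarrow> 'b) \<Rightarrow> bool" where
  "multiadditive V W n f \<longleftrightarrow>
    (\<forall>xs. length xs = n \<and> set xs \<subseteq> carrier V \<longrightarrow> f xs \<in> carrier W) \<and>
    (\<forall>xs i x y. length xs = n \<and> set xs \<subseteq> carrier V \<and> i < n \<and> x \<in> carrier V \<and> y \<in> carrier V \<longrightarrow>
      f (xs[i := x \<oplus>\<^bsub>V\<^esub> y]) = f (xs[i := x]) \<oplus>\<^bsub>W\<^esub> f (xs[i := y]))"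

lemma multiadditive_slot_hom:
  assumes "multiadditive V W n f" "abelian_group V" "abelian_group W"
    and "length xs = n" "set xs \<subseteq> carrier V" "i < n"
  shows "abelian_group_hom V W (\<lambda>x. f (xs[i := x]))"
proof (rule abelian_group.abelian_group_hom_into)
  fix x assume "x \<in> carrier V"
  then have "set (xs[i := x]) \<subseteq> carrier V"
    using assms by (meson insert_subset order_trans set_update_subset_insert)
  then show "f (xs[i := x]) \<in> carrier W"
    using assms by (auto simp: multiadditive_def)
qed (use assms in \<open>auto simp: multiadditive_def\<close>)

lemma multiadditive_zero:
  assumes "multiadditive V W n f" "abelian_group V" "abelian_group W"
    and "length xs = n" "set xs \<subseteq> carrier V" "i < n" "xs ! i = \<zero>\<^bsub>V\<^esub>"
  shows "f xs = \<zero>\<^bsub>W\<^esub>"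
proof -
  interpret abelian_group_hom V W "\<lambda>x. f (xs[i := x])"
    using assms by (intro multiadditive_slot_hom) auto
  show ?thesis
    using hom_zero assms(7) by (metis list_update_id)
qed

lemma tensors_iff: "xs \<in> tensors V n \<longleftrightarrow> length xs = n \<and> set xs \<subseteq> carrier V"
  by (simp add: tensors_def)

lemma tensors_permute_list:
  assumes "\<sigma> permutes {..<n}" "xs \<in> tensors V n"
  shows "permute_list \<sigma> xs \<in> tensors V n"
  using assms by (auto simp: tensors_def)

lemma tensor_maps_multiadditive: "f \<in> tensor_maps R V n p \<Longrightarrow> multiadditive V V n f"
  unfolding tensor_maps_def multiadditive_def by (auto simp: tensors_def)

lemma tensor_maps_closed: "f \<in> tensor_maps R V n p \<Longrightarrow> xs \<in> tensors V n \<Longrightarrow> f xs \<in> carrier V"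
  by (auto simp: tensor_maps_def)

lemma tensor_maps_degree:
  "f \<in> tensor_maps R V n p \<Longrightarrow> length xs = n \<Longrightarrow> homogeneous V ds xs
    \<Longrightarrow> f xs \<in> component V (sum_list ds + p)"
  by (auto simp: tensor_maps_def)

lemma tensor_maps_smult:
  "f \<in> tensor_maps R V n p \<Longrightarrow> xs \<in> tensors V n \<Longrightarrow> i < n \<Longrightarrow> c \<in> carrier R \<Longrightarrow> x \<in> carrier V
    \<Longrightarrow> f (xs[i := c \<odot>\<^bsub>V\<^esub> x]) = c \<odot>\<^bsub>V\<^esub> f (xs[i := x])"
  by (auto simp: tensor_maps_def)

lemma homogeneous_permute_list:
  assumes "homogeneous V ds xs" "\<sigma> permutes {..<length xs}"
  shows "homogeneous V (permute_list \<sigma> ds) (permute_list \<sigma> xs)"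
  using assms unfolding homogeneous_def
  by (metis list_all2_lengthD list_all2_permute_list_iff)

lemma permute_list_update:
  assumes "\<sigma> permutes {..<length xs}" "i < length xs"
  shows "permute_list \<sigma> (xs[i := x]) = (permute_list \<sigma> xs)[inv_into UNIV \<sigma> i := x]"
proof (rule nth_equalityI)
  fix j assume "j < length (permute_list \<sigma> (xs[i := x]))"
  then have j: "j < length xs" by simp
  then have "\<sigma> j < length xs"
    using permutes_in_image[OF assms(1), of j] by simp
  moreover have "i = \<sigma> j \<longleftrightarrow> inv_into UNIV \<sigma> i = j"
    using permutes_inv_eq[OF assms(1)] by auto
  moreover have "inv_into UNIV \<sigma> i < length xs"
    using permutes_in_image[OF permutes_inv[OF assms(1)], of i] assms(2) by simp
  ultimately show "permute_list \<sigma> (xs[i := x]) ! j = (permute_list \<sigma> xs)[inv_into UNIV \<sigma> i := x] ! j"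
    using assms j by (auto simp: permute_list_nth nth_list_update)
qed simp

lemma permute_list_sum_list:
  fixes ds :: "int list"
  assumes "\<sigma> permutes {..<length ds}"
  shows "sum_list (permute_list \<sigma> ds) = sum_list ds"
  using assms by (metis mset_permute_list sum_mset_sum_list)

lemma chi_cong_parity:
  assumes "\<sigma> permutes {..<length ds}" "length es = length ds"
    and "\<And>i. i < length ds \<Longrightarrow> even (ds ! i) \<longleftrightarrow> even (es ! i)"
  shows "chi ds \<sigma> = chi es \<sigma>"
proof -
  have "- msign (ds ! a * ds ! b) = - msign (es ! a * es ! b)"
    if "a \<in> set (map \<sigma> [0..<length ds])" "b \<in> set (map \<sigma> [0..<length ds])" for a b
  proof -
    have "a \<in> {..<length ds}" "b \<in> {..<length ds}"
      using that permutes_image[OF assms(1)] by (auto simp: lessThan_atLeast0)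
    then show ?thesis
      using assms(3) by (simp add: msign_def)
  qed
  then have "chi_word (nth ds) (map \<sigma> [0..<length ds]) = chi_word (nth es) (map \<sigma> [0..<length ds])"
    by (rule word_sign_cong)
  then show ?thesis
    using assms(1,2) by (simp add: chi_eq_chi_word)
qed

section \<open>Homogeneous components and parity parts of vectors\<close>

context graded_vector_space
begin

lemma component_subset: "component V d \<subseteq> carrier V"
  using submoduleE(1)[OF component_submodule] .

lemma component_closed: "x \<in> component V d \<Longrightarrow> x \<in> carrier V"
  using component_subset by blast

lemma component_zero: "\<zero>\<^bsub>V\<^esub> \<in> component V d"
  using subgroup.one_closed[OF submodule.axioms(1)[OF component_submodule]] by simp

lemma component_add: "x \<in> component V d \<Longrightarrow> y \<in> component V d \<Longrightarrow> x \<oplus>\<^bsub>V\<^esub> y \<in> component V d"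
  using submoduleE(5)[OF component_submodule] .

lemma component_smult: "c \<in> carrier R \<Longrightarrow> x \<in> component V d \<Longrightarrow> c \<odot>\<^bsub>V\<^esub> x \<in> component V d"
  using submoduleE(4)[OF component_submodule] .

lemma component_add_pow: "x \<in> component V d \<Longrightarrow> [(s::int)] \<cdot>\<^bsub>V\<^esub> x \<in> component V d"
proof -
  assume x: "x \<in> component V d"
  have sub: "subgroup (component V d) (add_monoid V)"
    using component_submodule by (rule submodule.axioms(1))
  show ?thesis
    using group.int_pow_closed[OF subgroup.subgroup_is_group[OF sub M.a_group], of x s]
      group.int_pow_consistent[OF M.a_group sub x, of s] x
    by (simp add: add_pow_def)
qed

lemma component_finsum:
  "(\<And>a. a \<in> A \<Longrightarrow> f a \<in> component V d) \<Longrightarrow> finsum V f A \<in> component V d"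
proof (induction A rule: infinite_finite_induct)
  case (insert a A)
  then show ?case
    using component_closed by (subst M.finsum_insert) (auto intro!: component_add)
qed (auto simp: component_zero)

lemma homogeneous_tensors: "homogeneous V ds xs \<Longrightarrow> length xs = n \<Longrightarrow> xs \<in> tensors V n"
  unfolding homogeneous_def tensors_iff list_all2_conv_all_nth subset_eq
  by (metis component_closed in_set_conv_nth)

definition part :: "'v \<Rightarrow> int \<Rightarrow> 'v" where
  "part v = (THE c. (\<forall>d. c d \<in> component V d) \<and> finite {d. c d \<noteq> \<zero>\<^bsub>V\<^esub>} \<and>
    v = (\<Oplus>\<^bsub>V\<^esub>d\<in>{d. c d \<noteq> \<zero>\<^bsub>V\<^esub>}. c d))"

lemma
  assumes "v \<in> carrier V"
  shows part_component: "part v d \<in> component V d"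
    and part_finite: "finite {d. part v d \<noteq> \<zero>\<^bsub>V\<^esub>}"
    and part_sum: "v = (\<Oplus>\<^bsub>V\<^esub>d\<in>{d. part v d \<noteq> \<zero>\<^bsub>V\<^esub>}. part v d)"
  using theI'[OF direct_sum[OF assms]] unfolding part_def by blast+

lemma part_closed: "v \<in> carrier V \<Longrightarrow> part v d \<in> carrier V"
  using part_component component_closed by blast

lemma finsum_support:
  assumes "finite D" "\<And>d. f d \<in> carrier V" "\<And>d. d \<notin> D \<Longrightarrow> f d = \<zero>\<^bsub>V\<^esub>"
  shows "(\<Oplus>\<^bsub>V\<^esub>d\<in>{d. f d \<noteq> \<zero>\<^bsub>V\<^esub>}. f d) = (\<Oplus>\<^bsub>V\<^esub>d\<in>D. f d)"
  using assms by (intro M.add.finprod_mono_neutral_cong_left) auto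

lemma part_eqI:
  assumes D: "finite D" and c: "\<And>d. c d \<in> component V d" "\<And>d. d \<notin> D \<Longrightarrow> c d = \<zero>\<^bsub>V\<^esub>"
    and v: "v = (\<Oplus>\<^bsub>V\<^esub>d\<in>D. c d)"
  shows "part v = c"
proof -
  have carr: "c d \<in> carrier V" for d
    using c(1) component_closed by blast
  have "finite {d. c d \<noteq> \<zero>\<^bsub>V\<^esub>}"
    using c(2) by (intro finite_subset[OF _ D]) auto
  moreover have "v = (\<Oplus>\<^bsub>V\<^esub>d\<in>{d. c d \<noteq> \<zero>\<^bsub>V\<^esub>}. c d)"
    using finsum_support[of D c] D carr c(2) v by simp
  moreover have "v \<in> carrier V"
    using v carr by simp
  ultimately show ?thesis
    unfolding part_def using c(1) by (intro the1_equality direct_sum) auto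
qed

lemma part_sum_superset:
  assumes "v \<in> carrier V" "finite D" "{d. part v d \<noteq> \<zero>\<^bsub>V\<^esub>} \<subseteq> D"
  shows "v = (\<Oplus>\<^bsub>V\<^esub>d\<in>D. part v d)"
  using finsum_support[of D "part v"] part_sum[OF assms(1)] assms part_closed by auto

lemma part_add:
  assumes "x \<in> carrier V" "y \<in> carrier V"
  shows "part (x \<oplus>\<^bsub>V\<^esub> y) = (\<lambda>d. part x d \<oplus>\<^bsub>V\<^esub> part y d)"
proof -
  let ?D = "{d. part x d \<noteq> \<zero>\<^bsub>V\<^esub>} \<union> {d. part y d \<noteq> \<zero>\<^bsub>V\<^esub>}"
  have fin: "finite ?D"
    using assms part_finite by simp
  show ?thesis
  proof (rule part_eqI[OF fin])
    have "x \<oplus>\<^bsub>V\<^esub> y = (\<Oplus>\<^bsub>V\<^esub>d\<in>?D. part x d) \<oplus>\<^bsub>V\<^esub> (\<Oplus>\<^bsub>V\<^esub>d\<in>?D. part y d)"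
      using part_sum_superset[OF assms(1) fin] part_sum_superset[OF assms(2) fin] by simp
    also have "\<dots> = (\<Oplus>\<^bsub>V\<^esub>d\<in>?D. part x d \<oplus>\<^bsub>V\<^esub> part y d)"
      using assms part_closed by (intro M.finsum_addf[symmetric]) auto
    finally show "x \<oplus>\<^bsub>V\<^esub> y = \<dots>" .
  qed (use assms part_component component_add in auto)
qed

lemma part_smult:
  assumes "c \<in> carrier R" "x \<in> carrier V"
  shows "part (c \<odot>\<^bsub>V\<^esub> x) = (\<lambda>d. c \<odot>\<^bsub>V\<^esub> part x d)"
proof (rule part_eqI[OF part_finite[OF assms(2)]])
  have "c \<odot>\<^bsub>V\<^esub> x = c \<odot>\<^bsub>V\<^esub> (\<Oplus>\<^bsub>V\<^esub>d\<in>{d. part x d \<noteq> \<zero>\<^bsub>V\<^esub>}. part x d)"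
    using part_sum[OF assms(2)] by simp
  also have "\<dots> = (\<Oplus>\<^bsub>V\<^esub>d\<in>{d. part x d \<noteq> \<zero>\<^bsub>V\<^esub>}. c \<odot>\<^bsub>V\<^esub> part x d)"
    using assms part_closed part_finite by (intro finsum_smult_ldistr) auto
  finally show "c \<odot>\<^bsub>V\<^esub> x = \<dots>" .
qed (use assms part_component component_smult in auto)

lemma part_homogeneous:
  assumes "x \<in> component V d"
  shows "part x = (\<lambda>d'. if d' = d then x else \<zero>\<^bsub>V\<^esub>)"
  using assms component_closed[OF assms] by (intro part_eqI[of "{d}"]) (auto simp: component_zero)

text \<open>Components of the wrong parity are replaced by zero instead of being removed from the
  index set, so that several vectors can be summed over one common finite index set.\<close>

definition parity_part :: "int \<Rightarrow> 'v \<Rightarrow> 'v" where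
  "parity_part p v = (\<Oplus>\<^bsub>V\<^esub>d\<in>{d. part v d \<noteq> \<zero>\<^bsub>V\<^esub>}. if even d = even p then part v d else \<zero>\<^bsub>V\<^esub>)"

lemma parity_part_closed: "v \<in> carrier V \<Longrightarrow> parity_part p v \<in> carrier V"
  unfolding parity_part_def using part_closed by auto

lemma parity_part_superset:
  assumes "v \<in> carrier V" "finite D" "{d. part v d \<noteq> \<zero>\<^bsub>V\<^esub>} \<subseteq> D"
  shows "parity_part p v = (\<Oplus>\<^bsub>V\<^esub>d\<in>D. if even d = even p then part v d else \<zero>\<^bsub>V\<^esub>)"
  unfolding parity_part_def using assms part_closed
  by (intro M.add.finprod_mono_neutral_cong_left) auto

lemma parity_part_add:
  assumes "x \<in> carrier V" "y \<in> carrier V"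
  shows "parity_part p (x \<oplus>\<^bsub>V\<^esub> y) = parity_part p x \<oplus>\<^bsub>V\<^esub> parity_part p y"
proof -
  let ?D = "{d. part x d \<noteq> \<zero>\<^bsub>V\<^esub>} \<union> {d. part y d \<noteq> \<zero>\<^bsub>V\<^esub>}"
  have D: "finite ?D" "{d. part (x \<oplus>\<^bsub>V\<^esub> y) d \<noteq> \<zero>\<^bsub>V\<^esub>} \<subseteq> ?D"
    using assms part_finite by (auto simp: part_add)
  have "parity_part p (x \<oplus>\<^bsub>V\<^esub> y)
      = (\<Oplus>\<^bsub>V\<^esub>d\<in>?D. if even d = even p then part (x \<oplus>\<^bsub>V\<^esub> y) d else \<zero>\<^bsub>V\<^esub>)"
    using assms D by (intro parity_part_superset) auto
  also have "\<dots> = (\<Oplus>\<^bsub>V\<^esub>d\<in>?D. (if even d = even p then part x d else \<zero>\<^bsub>V\<^esub>)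
      \<oplus>\<^bsub>V\<^esub> (if even d = even p then part y d else \<zero>\<^bsub>V\<^esub>))"
    using assms part_closed by (intro M.finsum_cong') (auto simp: part_add)
  also have "\<dots> = parity_part p x \<oplus>\<^bsub>V\<^esub> parity_part p y"
    using assms D(1) part_closed
    by (subst M.finsum_addf) (auto simp: parity_part_superset[of _ ?D])
  finally show ?thesis .
qed

lemma parity_part_smult:
  assumes "c \<in> carrier R" "x \<in> carrier V"
  shows "parity_part p (c \<odot>\<^bsub>V\<^esub> x) = c \<odot>\<^bsub>V\<^esub> parity_part p x"
proof -
  let ?D = "{d. part x d \<noteq> \<zero>\<^bsub>V\<^esub>}"
  have D: "finite ?D" "{d. part (c \<odot>\<^bsub>V\<^esub> x) d \<noteq> \<zero>\<^bsub>V\<^esub>} \<subseteq> ?D"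
    using assms part_finite by (auto simp: part_smult)
  have "parity_part p (c \<odot>\<^bsub>V\<^esub> x)
      = (\<Oplus>\<^bsub>V\<^esub>d\<in>?D. if even d = even p then part (c \<odot>\<^bsub>V\<^esub> x) d else \<zero>\<^bsub>V\<^esub>)"
    using assms D by (intro parity_part_superset) auto
  also have "\<dots> = (\<Oplus>\<^bsub>V\<^esub>d\<in>?D. c \<odot>\<^bsub>V\<^esub> (if even d = even p then part x d else \<zero>\<^bsub>V\<^esub>))"
    using assms part_closed by (intro M.finsum_cong') (auto simp: part_smult)
  also have "\<dots> = c \<odot>\<^bsub>V\<^esub> parity_part p x"
    unfolding parity_part_def
    using assms D(1) part_closed by (intro finsum_smult_ldistr[symmetric]) auto
  finally show ?thesis .
qed

lemma parity_part_homogeneous: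
  assumes "x \<in> component V d"
  shows "parity_part p x = (if even d = even p then x else \<zero>\<^bsub>V\<^esub>)"
proof -
  have "parity_part p x = (\<Oplus>\<^bsub>V\<^esub>d'\<in>{d}. if even d' = even p then part x d' else \<zero>\<^bsub>V\<^esub>)"
    using component_closed[OF assms]
    by (intro parity_part_superset) (auto simp: part_homogeneous[OF assms])
  then show ?thesis
    using component_closed[OF assms] by (simp add: part_homogeneous[OF assms])
qed

text \<open>Additivity in a slot expands its entry into homogeneous parts, and doing so slot by slot
  reduces the claim to homogeneous tensors. This gives the uniqueness behind
  \<open>antisymmetrization\<close> and later extends the morphism equation to all tensors.\<close>

lemma multiadditive_eqI:
  assumes W: "abelian_group W" and f: "multiadditive V W n f" and g: "multiadditive V W n g"
    and eq: "\<And>ds xs. length xs = n \<Longrightarrow> homogeneous V ds xs \<Longrightarrow> f xs = g xs"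
    and xs: "xs \<in> tensors V n"
  shows "f xs = g xs"
proof -
  \<comment> \<open>Slots below \<open>k\<close> are arbitrary and those from \<open>k\<close> on
    are homogeneous. Under \<open>Suc k\<close>, slot \<open>k\<close> is the last free one, and it
    is the one that the induction step expands.\<close>
  have claim: "f xs = g xs" if "k \<le> n" "xs \<in> tensors V n"
    "\<forall>i. k \<le> i \<and> i < n \<longrightarrow> (\<exists>d. xs ! i \<in> component V d)" for k xs
    using that
  proof (induction k arbitrary: xs)
    case 0
    then obtain d where "\<forall>i<n. xs ! i \<in> component V (d i)"
      by (metis le0)
    with 0 have "homogeneous V (map d [0..<n]) xs"
      by (simp add: homogeneous_def list_all2_conv_all_nth tensors_iff)
    with 0 show ?case
      by (intro eq) (auto simp: tensors_iff)
  next
    case (Suc k)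
    have xs: "length xs = n" "set xs \<subseteq> carrier V"
      using Suc.prems by (auto simp: tensors_iff)
    interpret f: abelian_group_hom V W "\<lambda>x. f (xs[k := x])"
      using Suc.prems xs by (intro multiadditive_slot_hom[OF f _ W] M.abelian_group_axioms) auto
    interpret g: abelian_group_hom V W "\<lambda>x. g (xs[k := x])"
      using Suc.prems xs by (intro multiadditive_slot_hom[OF g _ W] M.abelian_group_axioms) auto
    have xk: "xs ! k \<in> carrier V"
      using Suc.prems xs by (metis Suc_le_lessD nth_mem subsetD)
    have "f (xs[k := part (xs ! k) d]) = g (xs[k := part (xs ! k) d])" for d
    proof (rule Suc.IH)
      show "xs[k := part (xs ! k) d] \<in> tensors V n"
        using xs part_closed[OF xk] set_update_subset_insert[of xs k "part (xs ! k) d"]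
        by (auto simp: tensors_iff)
      show "\<forall>i. k \<le> i \<and> i < n \<longrightarrow> (\<exists>d'. xs[k := part (xs ! k) d] ! i \<in> component V d')"
        using Suc.prems xs part_component[OF xk] 
        by (metis le_neq_implies_less nth_list_update_eq nth_list_update_neq not_less_eq_eq linorder_not_le)
    qed (use Suc.prems in simp)
    then have "(\<Oplus>\<^bsub>W\<^esub>d\<in>{d. part (xs ! k) d \<noteq> \<zero>\<^bsub>V\<^esub>}. f (xs[k := part (xs ! k) d]))
      = (\<Oplus>\<^bsub>W\<^esub>d\<in>{d. part (xs ! k) d \<noteq> \<zero>\<^bsub>V\<^esub>}. g (xs[k := part (xs ! k) d]))"
      by simp
    then have "f (xs[k := xs ! k]) = g (xs[k := xs ! k])"
      using f.hom_finsum[of "part (xs ! k)" "{d. part (xs ! k) d \<noteq> \<zero>\<^bsub>V\<^esub>}"]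
        g.hom_finsum[of "part (xs ! k)" "{d. part (xs ! k) d \<noteq> \<zero>\<^bsub>V\<^esub>}"]
        part_sum[OF xk] part_closed[OF xk] by simp
    then show ?case
      by simp
  qed
  show ?thesis
    by (rule claim[of n]) (use xs in auto)
qed

section \<open>The antisymmetrization on inhomogeneous tensors\<close>

definition parity_lists :: "nat \<Rightarrow> int list set" where
  "parity_lists n = {ps. set ps \<subseteq> {0, 1} \<and> length ps = n}"

lemma finite_parity_lists: "finite (parity_lists n)"
  unfolding parity_lists_def by (rule finite_lists_length_eq) simp

text \<open>The signs only depend on parities, so the antisymmetrization of \<open>f\<close> is defined on all tensors
  by splitting every argument into its even and its odd part.\<close>

definition alternation :: "nat \<Rightarrow> ('v list \<Rightarrow> 'v) \<Rightarrow> 'v list \<Rightarrow> 'v" where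
  "alternation n f = (\<lambda>xs\<in>tensors V n. \<Oplus>\<^bsub>V\<^esub>ps\<in>parity_lists n. \<Oplus>\<^bsub>V\<^esub>\<sigma>\<in>{\<sigma>. \<sigma> permutes {..<n}}.
    [chi ps \<sigma>] \<cdot>\<^bsub>V\<^esub> f (permute_list \<sigma> (map2 parity_part ps xs)))"

lemma tensors_update: "xs \<in> tensors V n \<Longrightarrow> x \<in> carrier V \<Longrightarrow> xs[i := x] \<in> tensors V n"
  using set_update_subset_insert[of xs i x] by (auto simp: tensors_iff)

lemma map2_parity_part_tensors:
  assumes "ps \<in> parity_lists n" "xs \<in> tensors V n"
  shows "map2 parity_part ps xs \<in> tensors V n"
  using assms parity_part_closed by (auto simp: tensors_iff parity_lists_def dest!: set_zip_rightD)

lemma map2_parity_part_update: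
  assumes "length ps = length xs"
  shows "map2 parity_part ps (xs[i := x]) = (map2 parity_part ps xs)[i := parity_part (ps ! i) x]"
proof (rule nth_equalityI)
  fix j assume "j < length (map2 parity_part ps (xs[i := x]))"
  with assms show "map2 parity_part ps (xs[i := x]) ! j
      = (map2 parity_part ps xs)[i := parity_part (ps ! i) x] ! j"
    by (cases "j = i") auto
qed simp

lemma alternation_closed:
  assumes "f \<in> tensor_maps R V n p" "xs \<in> tensors V n"
  shows "alternation n f xs \<in> carrier V"
  using assms tensor_maps_closed tensors_permute_list map2_parity_part_tensors
  by (fastforce simp: alternation_def intro!: M.finsum_closed)

text \<open>A homogeneous argument has at most one nonzero parity part. A parity list other than the
  reduction of \<open>ds\<close> mod 2 therefore puts a zero into some slot, and the summand
  vanishes by additivity there. For the remaining list the arguments are unchanged, and its signs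
  agree with those of \<open>ds\<close> by \<open>chi_cong_parity\<close>.\<close>

lemma alternation_homogeneous:
  assumes f: "f \<in> tensor_maps R V n p" and xs: "length xs = n" and hom: "homogeneous V ds xs"
  shows "alternation n f xs
    = (\<Oplus>\<^bsub>V\<^esub>\<sigma>\<in>{\<sigma>. \<sigma> permutes {..<n}}. [chi ds \<sigma>] \<cdot>\<^bsub>V\<^esub> f (permute_list \<sigma> xs))"
proof -
  let ?S = "{\<sigma>. \<sigma> permutes {..<n}}"
  let ?qs = "map (\<lambda>d. d mod 2) ds"
  let ?T = "\<lambda>ps. \<Oplus>\<^bsub>V\<^esub>\<sigma>\<in>?S. [chi ps \<sigma>] \<cdot>\<^bsub>V\<^esub> f (permute_list \<sigma> (map2 parity_part ps xs))"
  have len: "length ds = n"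
    using hom xs by (auto simp: homogeneous_def dest: list_all2_lengthD)
  have comp: "xs ! i \<in> component V (ds ! i)" if "i < n" for i
    using hom that len by (simp add: homogeneous_def list_all2_conv_all_nth)
  have tens: "xs \<in> tensors V n"
    using hom xs by (rule homogeneous_tensors)
  have closed: "[chi es \<sigma>] \<cdot>\<^bsub>V\<^esub> f (permute_list \<sigma> ys) \<in> carrier V"
    if "\<sigma> \<in> ?S" "ys \<in> tensors V n" for es \<sigma> ys
    using tensor_maps_closed[OF f tensors_permute_list[of \<sigma> n ys]] that by simp
  have nth: "map2 parity_part ps xs ! i = (if even (ds ! i) = even (ps ! i) then xs ! i else \<zero>\<^bsub>V\<^esub>)"
    if "i < n" "length ps = n" for ps i
    using that xs parity_part_homogeneous[OF comp] by simp
  have qs: "?qs \<in> parity_lists n"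
    using len by (auto simp: parity_lists_def)
  have zero: "?T ps = \<zero>\<^bsub>V\<^esub>" if ps: "ps \<in> parity_lists n" "ps \<noteq> ?qs" for ps
  proof -
    obtain i where i: "i < n" "ps ! i \<noteq> ds ! i mod 2"
      using ps len by (auto simp: parity_lists_def list_eq_iff_nth_eq)
    have "ps ! i \<in> {0, 1}"
      using ps i by (metis (mono_tags, lifting) mem_Collect_eq nth_mem parity_lists_def subsetD)
    then have 0: "map2 parity_part ps xs ! i = \<zero>\<^bsub>V\<^esub>"
      using i ps nth[of i ps] by (auto simp: parity_lists_def)
    have "f (permute_list \<sigma> (map2 parity_part ps xs)) = \<zero>\<^bsub>V\<^esub>" if \<sigma>: "\<sigma> permutes {..<n}" for \<sigma>
    proof (rule multiadditive_zero)
      show "multiadditive V V n f"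
        using f by (rule tensor_maps_multiadditive)
      have ts: "permute_list \<sigma> (map2 parity_part ps xs) \<in> tensors V n"
        using \<sigma> ps tens map2_parity_part_tensors by (intro tensors_permute_list) auto
      then show "length (permute_list \<sigma> (map2 parity_part ps xs)) = n"
        "set (permute_list \<sigma> (map2 parity_part ps xs)) \<subseteq> carrier V"
        by (auto simp: tensors_iff)
      show i': "inv_into UNIV \<sigma> i < n"
        using permutes_in_image[OF permutes_inv[OF \<sigma>], of i] i by simp
      show "permute_list \<sigma> (map2 parity_part ps xs) ! inv_into UNIV \<sigma> i = \<zero>\<^bsub>V\<^esub>"
        using permute_list_nth[of \<sigma> "map2 parity_part ps xs" "inv_into UNIV \<sigma> i"] \<sigma> i' 0 ps xs
        by (simp add: parity_lists_def permutes_inverses)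
    qed (rule M.abelian_group_axioms)+
    then show ?thesis
      by (intro M.add.finprod_one_eqI) auto
  qed
  have "alternation n f xs = (\<Oplus>\<^bsub>V\<^esub>ps\<in>parity_lists n. ?T ps)"
    using tens by (simp add: alternation_def)
  also have "\<dots> = (\<Oplus>\<^bsub>V\<^esub>ps\<in>parity_lists n. if ?qs = ps then ?T ps else \<zero>\<^bsub>V\<^esub>)"
    using zero closed tens map2_parity_part_tensors
    by (intro M.finsum_cong') (auto intro!: M.finsum_closed)
  also have "\<dots> = ?T ?qs"
    using closed tens qs finite_parity_lists map2_parity_part_tensors
    by (intro M.finsum_singleton) (auto intro!: M.finsum_closed)
  also have "map2 parity_part ?qs xs = xs"
    using len xs nth[of _ ?qs] by (intro nth_equalityI) auto
  also have "(\<Oplus>\<^bsub>V\<^esub>\<sigma>\<in>?S. [chi ?qs \<sigma>] \<cdot>\<^bsub>V\<^esub> f (permute_list \<sigma> xs))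
      = (\<Oplus>\<^bsub>V\<^esub>\<sigma>\<in>?S. [chi ds \<sigma>] \<cdot>\<^bsub>V\<^esub> f (permute_list \<sigma> xs))"
    using closed[OF _ tens] len chi_cong_parity[of _ ds ?qs] by (intro M.finsum_cong') auto
  finally show ?thesis .
qed

lemma alternation_tensor_maps:
  assumes f: "f \<in> tensor_maps R V n p"
  shows "alternation n f \<in> tensor_maps R V n p"
proof -
  let ?S = "{\<sigma>. \<sigma> permutes {..<n}}"
  let ?T = "\<lambda>ps \<sigma> xs. [chi ps \<sigma>] \<cdot>\<^bsub>V\<^esub> f (permute_list \<sigma> (map2 parity_part ps xs))"
  have fin: "finite ?S"
    by (simp add: finite_permutations)
  have closed: "?T ps \<sigma> xs \<in> carrier V"
    if "ps \<in> parity_lists n" "\<sigma> \<in> ?S" "xs \<in> tensors V n" for ps \<sigma> xs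
    using tensor_maps_closed[OF f tensors_permute_list[OF _ map2_parity_part_tensors]] that by simp
  \<comment> \<open>An argument in slot \<open>i\<close> reaches \<open>f\<close> in slot
    \<sigma>^-1(i); linearity of \<open>f\<close> in that slot makes each summand linear in slot
    \<open>i\<close>.\<close>
  have permute: "permute_list \<sigma> (map2 parity_part ps (xs[i := x]))
      = (permute_list \<sigma> (map2 parity_part ps xs))[inv_into UNIV \<sigma> i := parity_part (ps ! i) x]"
    and inv: "inv_into UNIV \<sigma> i < n"
    and tens: "permute_list \<sigma> (map2 parity_part ps xs) \<in> tensors V n"
    if "ps \<in> parity_lists n" "\<sigma> \<in> ?S" "xs \<in> tensors V n" "i < n" for ps \<sigma> xs i x
    using that permutes_in_image[OF permutes_inv, of \<sigma> "{..<n}" i] map2_parity_part_tensors[of ps n xs]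
    by (auto simp: map2_parity_part_update permute_list_update parity_lists_def tensors_iff)
  have add: "?T ps \<sigma> (xs[i := x \<oplus>\<^bsub>V\<^esub> y]) = ?T ps \<sigma> (xs[i := x]) \<oplus>\<^bsub>V\<^esub> ?T ps \<sigma> (xs[i := y])"
    if *: "ps \<in> parity_lists n" "\<sigma> \<in> ?S" "xs \<in> tensors V n" "i < n" and xy: "x \<in> carrier V" "y \<in> carrier V"
    for ps \<sigma> xs i x y
  proof -
    interpret abelian_group_hom V V
      "\<lambda>x. f ((permute_list \<sigma> (map2 parity_part ps xs))[inv_into UNIV \<sigma> i := x])"
      using tens[OF *] inv[OF *] f M.abelian_group_axioms
      by (intro multiadditive_slot_hom) (auto simp: tensors_iff tensor_maps_multiadditive)
    show ?thesis
      using xy by (simp add: permute[OF *] parity_part_add parity_part_closed M.add.int_pow_distrib)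
  qed
  have smult: "?T ps \<sigma> (xs[i := c \<odot>\<^bsub>V\<^esub> x]) = c \<odot>\<^bsub>V\<^esub> ?T ps \<sigma> (xs[i := x])"
    if *: "ps \<in> parity_lists n" "\<sigma> \<in> ?S" "xs \<in> tensors V n" "i < n" and cx: "c \<in> carrier R" "x \<in> carrier V"
    for ps \<sigma> xs i c x
  proof -
    interpret abelian_group_hom V V "\<lambda>x. c \<odot>\<^bsub>V\<^esub> x"
      using cx by (intro M.abelian_group_hom_into M.abelian_group_axioms) (auto simp: smult_r_distr)
    show ?thesis
      using cx inv[OF *] tens[OF *] tensor_maps_smult[OF f tens[OF *] inv[OF *]]
        tensor_maps_closed[OF f tensors_update[OF tens[OF *]]]
      by (simp add: permute[OF *] parity_part_smult parity_part_closed hom_add_pow_int)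
  qed
  show ?thesis
    unfolding tensor_maps_def
  proof (intro CollectI conjI ballI allI impI)
    show "alternation n f \<in> tensors V n \<rightarrow>\<^sub>E carrier V"
      using alternation_closed[OF f] by (auto simp: alternation_def)
  next
    fix xs i x y
    assume *: "xs \<in> tensors V n" "i < n" "x \<in> carrier V" "y \<in> carrier V"
    have "alternation n f (xs[i := x \<oplus>\<^bsub>V\<^esub> y]) = (\<Oplus>\<^bsub>V\<^esub>ps\<in>parity_lists n. \<Oplus>\<^bsub>V\<^esub>\<sigma>\<in>?S.
        ?T ps \<sigma> (xs[i := x]) \<oplus>\<^bsub>V\<^esub> ?T ps \<sigma> (xs[i := y]))"
      using * closed tensors_update
      by (auto simp: alternation_def add intro!: M.finsum_cong' M.finsum_closed)
    also have "\<dots> = (\<Oplus>\<^bsub>V\<^esub>ps\<in>parity_lists n. (\<Oplus>\<^bsub>V\<^esub>\<sigma>\<in>?S. ?T ps \<sigma> (xs[i := x]))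
        \<oplus>\<^bsub>V\<^esub> (\<Oplus>\<^bsub>V\<^esub>\<sigma>\<in>?S. ?T ps \<sigma> (xs[i := y])))"
      using * closed tensors_update by (intro M.finsum_cong' M.finsum_addf) auto
    also have "\<dots> = alternation n f (xs[i := x]) \<oplus>\<^bsub>V\<^esub> alternation n f (xs[i := y])"
      using * closed tensors_update by (subst M.finsum_addf) (auto simp: alternation_def)
    finally show "alternation n f (xs[i := x \<oplus>\<^bsub>V\<^esub> y])
      = alternation n f (xs[i := x]) \<oplus>\<^bsub>V\<^esub> alternation n f (xs[i := y])" .
  next
    fix xs i c x
    assume *: "xs \<in> tensors V n" "i < n" "c \<in> carrier R" "x \<in> carrier V"
    have "alternation n f (xs[i := c \<odot>\<^bsub>V\<^esub> x]) = (\<Oplus>\<^bsub>V\<^esub>ps\<in>parity_lists n. \<Oplus>\<^bsub>V\<^esub>\<sigma>\<in>?S.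
        c \<odot>\<^bsub>V\<^esub> ?T ps \<sigma> (xs[i := x]))"
      using * closed tensors_update
      by (auto simp: alternation_def smult intro!: M.finsum_cong' M.finsum_closed)
    also have "\<dots> = (\<Oplus>\<^bsub>V\<^esub>ps\<in>parity_lists n. c \<odot>\<^bsub>V\<^esub> (\<Oplus>\<^bsub>V\<^esub>\<sigma>\<in>?S. ?T ps \<sigma> (xs[i := x])))"
      using * closed tensors_update fin
      by (intro M.finsum_cong' finsum_smult_ldistr[symmetric]) auto
    also have "\<dots> = c \<odot>\<^bsub>V\<^esub> alternation n f (xs[i := x])"
      using * closed tensors_update finite_parity_lists
      by (subst finsum_smult_ldistr[symmetric]) (auto simp: alternation_def)
    finally show "alternation n f (xs[i := c \<odot>\<^bsub>V\<^esub> x]) = c \<odot>\<^bsub>V\<^esub> alternation n f (xs[i := x])" .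
  next
    fix ds xs
    assume "length xs = n \<and> homogeneous V ds xs"
    then have *: "length xs = n" "homogeneous V ds xs" "length ds = n"
      by (auto simp: homogeneous_def dest: list_all2_lengthD)
    have "f (permute_list \<sigma> xs) \<in> component V (sum_list ds + p)" if "\<sigma> \<in> ?S" for \<sigma>
      using tensor_maps_degree[OF f _ homogeneous_permute_list[OF *(2)], of \<sigma>] that *
      by (simp add: permute_list_sum_list)
    then show "alternation n f xs \<in> component V (sum_list ds + p)"
      unfolding alternation_homogeneous[OF f *(1,2)]
      by (intro component_finsum component_add_pow)
  qed
qed

lemma tensor_maps_eqI:
  assumes f: "f \<in> tensor_maps R V n p" and g: "g \<in> tensor_maps R V n p"
    and eq: "\<And>ds xs. length xs = n \<Longrightarrow> homogeneous V ds xs \<Longrightarrow> f xs = g xs"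
  shows "f = g"
proof
  fix xs show "f xs = g xs"
  proof (cases "xs \<in> tensors V n")
    case True
    then show ?thesis
      using multiadditive_eqI[OF M.abelian_group_axioms tensor_maps_multiadditive[OF f]
          tensor_maps_multiadditive[OF g]] eq by blast
  next
    case False
    then show ?thesis
      using f g by (auto simp: tensor_maps_def PiE_def extensional_def)
  qed
qed

text \<open>Resolves the definite description: \<open>alternation\<close> supplies a map with the
  prescribed values, and \<open>tensor_maps_eqI\<close> excludes a second one.\<close>

lemma antisymmetrization_eq_alternation:
  assumes "\<mu> n \<in> tensor_maps R V n (int n - 2)" "n \<in> arity_range m"
  shows "antisymmetrization R m V \<mu> n = alternation n (\<mu> n)"
proof -
  have "(THE f. f \<in> tensor_maps R V n (int n - 2) \<and>
     (\<forall>ds xs. length xs = n \<and> homogeneous V ds xs \<longrightarrow>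
        f xs = (\<Oplus>\<^bsub>V\<^esub>\<sigma>\<in>{\<sigma>. \<sigma> permutes {..<n}}. [chi ds \<sigma>] \<cdot>\<^bsub>V\<^esub> \<mu> n (permute_list \<sigma> xs)))) = alternation n (\<mu> n)"
  proof (rule the_equality)
    show "alternation n (\<mu> n) \<in> tensor_maps R V n (int n - 2) \<and>
     (\<forall>ds xs. length xs = n \<and> homogeneous V ds xs \<longrightarrow>
        alternation n (\<mu> n) xs = (\<Oplus>\<^bsub>V\<^esub>\<sigma>\<in>{\<sigma>. \<sigma> permutes {..<n}}. [chi ds \<sigma>] \<cdot>\<^bsub>V\<^esub> \<mu> n (permute_list \<sigma> xs)))"
      using alternation_tensor_maps[OF assms(1)] alternation_homogeneous[OF assms(1)] by blast
  next
    fix g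
    assume *: "g \<in> tensor_maps R V n (int n - 2) \<and>
     (\<forall>ds xs. length xs = n \<and> homogeneous V ds xs \<longrightarrow>
        g xs = (\<Oplus>\<^bsub>V\<^esub>\<sigma>\<in>{\<sigma>. \<sigma> permutes {..<n}}. [chi ds \<sigma>] \<cdot>\<^bsub>V\<^esub> \<mu> n (permute_list \<sigma> xs)))"
    show "g = alternation n (\<mu> n)"
    proof (rule tensor_maps_eqI)
      show "g \<in> tensor_maps R V n (int n - 2)"
        using * ..
      show "g xs = alternation n (\<mu> n) xs" if "length xs = n" "homogeneous V ds xs" for ds xs
        using * alternation_homogeneous[OF assms(1)] that by auto
    qed (rule alternation_tensor_maps[OF assms(1)])
  qed
  then show ?thesis
    using assms(2) by (simp add: antisymmetrization_def)
qed

end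

section \<open>Unshuffles and blocks\<close>

text \<open>A strictly increasing list is the sorted enumeration of its set, so both halves of an
  unshuffle are known once the image of the first \<open>i\<close> positions is known.\<close>

lemma unshuffle_sorted:
  assumes "\<sigma> \<in> unshuffles i n" "i \<le> n"
  shows "map \<sigma> [0..<i] = sorted_list_of_set (\<sigma> ` {..<i})"
    and "map \<sigma> [i..<n] = sorted_list_of_set ({..<n} - \<sigma> ` {..<i})"
proof -
  have \<sigma>: "\<sigma> permutes {..<n}" "strict_mono_on {..<i} \<sigma>" "strict_mono_on {i..<n} \<sigma>"
    using assms by (auto simp: unshuffles_def)
  have *: "map \<sigma> [a..<b] = sorted_list_of_set (\<sigma> ` {a..<b})" if "strict_mono_on {a..<b} \<sigma>" for a b
  proof -
    have "sorted_wrt (<) (map \<sigma> [a..<b])"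
      unfolding sorted_wrt_map
      by (rule sorted_wrt_mono_rel[OF _ sorted_wrt_upt]) (simp add: strict_mono_onD[OF that])
    then show ?thesis
      using sorted_list_of_set.idem_if_sorted_distinct[of "map \<sigma> [a..<b]"]
      by (simp add: strict_sorted_iff)
  qed
  show "map \<sigma> [0..<i] = sorted_list_of_set (\<sigma> ` {..<i})"
    using *[of 0 i] \<sigma>(2) by (simp add: lessThan_atLeast0)
  have "{i..<n} = {..<n} - {..<i}"
    using assms(2) by auto
  then have "{..<n} - \<sigma> ` {..<i} = \<sigma> ` {i..<n}"
    using permutes_image[OF \<sigma>(1)] image_set_diff[OF permutes_inj[OF \<sigma>(1)], of "{..<n}" "{..<i}"] by simp
  then show "map \<sigma> [i..<n] = sorted_list_of_set ({..<n} - \<sigma> ` {..<i})"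
    using *[OF \<sigma>(3)] by simp
qed

lemma bij_betw_unshuffles:
  assumes "i \<le> n"
  shows "bij_betw (\<lambda>\<sigma>. \<sigma> ` {..<i}) (unshuffles i n) {A. A \<subseteq> {..<n} \<and> card A = i}"
proof (rule bij_betw_imageI)
  show "inj_on (\<lambda>\<sigma>. \<sigma> ` {..<i}) (unshuffles i n)"
  proof (rule inj_onI)
    fix \<sigma> \<tau> assume *: "\<sigma> \<in> unshuffles i n" "\<tau> \<in> unshuffles i n" "\<sigma> ` {..<i} = \<tau> ` {..<i}"
    then have "map \<sigma> [0..<i] @ map \<sigma> [i..<n] = map \<tau> [0..<i] @ map \<tau> [i..<n]"
      using unshuffle_sorted assms by metis
    then have "map \<sigma> [0..<n] = map \<tau> [0..<n]"
      using assms upt_add_eq_append[of 0 i "n - i"] by (simp flip: map_append)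
    then have "\<sigma> k = \<tau> k" for k
      using * by (cases "k < n") (auto simp: unshuffles_def permutes_not_in)
    then show "\<sigma> = \<tau>" ..
  qed
next
  show "(\<lambda>\<sigma>. \<sigma> ` {..<i}) ` unshuffles i n = {A. A \<subseteq> {..<n} \<and> card A = i}"
  proof safe
    fix \<sigma> k assume "\<sigma> \<in> unshuffles i n" "k < i"
    then show "\<sigma> k < n"
      using assms permutes_in_image[of \<sigma> "{..<n}" k] by (auto simp: unshuffles_def)
  next
    fix \<sigma> assume "\<sigma> \<in> unshuffles i n"
    then have "inj_on \<sigma> {..<i}"
      by (auto simp: unshuffles_def intro: permutes_inj_on)
    then show "card (\<sigma> ` {..<i}) = i"
      by (simp add: card_image)
  next
    fix A assume A: "A \<subseteq> {..<n}" "i = card A"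
    let ?s = "sorted_list_of_set A" and ?t = "sorted_list_of_set ({..<n} - A)"
    \<comment> \<open>The unshuffle belonging to \<open>A\<close> lists \<open>A\<close> in order
      and then its complement; being the identity from \<open>n\<close> on is what
      \<open>permutes\<close> demands.\<close>
    define \<sigma> where "\<sigma> = (\<lambda>k. if k < n then (?s @ ?t) ! k else k)"
    have fin: "finite A"
      using A(1) finite_subset by blast
    have len: "length ?s = i" "length (?s @ ?t) = n"
      using A fin assms card_mono[OF _ A(1)] by (auto simp: card_Diff_subset)
    have set: "set (?s @ ?t) = {..<n}" and dist: "distinct (?s @ ?t)"
      using A fin by auto
    have "bij_betw (nth (?s @ ?t)) {..<n} {..<n}"
      using bij_betw_nth[OF dist _ set[symmetric]] len(2) by metis
    also have "?this \<longleftrightarrow> bij_betw \<sigma> {..<n} {..<n}"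
      by (rule bij_betw_cong) (simp add: \<sigma>_def)
    finally have "bij_betw \<sigma> {..<n} {..<n}" .
    then have "\<sigma> permutes {..<n}"
      by (rule bij_imp_permutes) (simp add: \<sigma>_def)
    moreover have "strict_mono_on {..<i} \<sigma>"
      using len assms strict_sorted_list_of_set[of A]
      by (auto simp: strict_mono_on_def \<sigma>_def nth_append sorted_wrt_iff_nth_less)
    moreover have "strict_mono_on {i..<n} \<sigma>"
    proof (rule strict_mono_onI)
      fix r s assume "r \<in> {i..<n}" "s \<in> {i..<n}" "r < s"
      then show "\<sigma> r < \<sigma> s"
        using len strict_sorted_list_of_set[of "{..<n} - A"]
        by (simp add: \<sigma>_def nth_append sorted_wrt_iff_nth_less)
    qed
    moreover have "\<sigma> ` {..<i} = nth ?s ` {..<i}"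
      using len assms by (intro image_cong) (auto simp: \<sigma>_def nth_append)
    then have "\<sigma> ` {..<i} = A"
      using nth_image[of i ?s] len(1) fin by (simp add: lessThan_atLeast0)
    ultimately show "A \<in> (\<lambda>\<sigma>. \<sigma> ` {..<card A}) ` unshuffles (card A) n"
      using A(2) by (auto simp: unshuffles_def)
  qed
qed

text \<open>A word \<open>u @ v @ w\<close> with a block \<open>v\<close> of length \<open>k\<close> corresponds to the word \<open>v\<close> together with the
  word in which the block is replaced by the letter \<open>0\<close> and the other letters are shifted by one.\<close>

definition collapse_block :: "nat \<Rightarrow> nat \<times> nat list \<Rightarrow> nat set \<times> nat list \<times> nat list" where
  "collapse_block k = (\<lambda>(l, w). (set (take k (drop l w)), take k (drop l w),
     map Suc (take l w) @ 0 # map Suc (drop (l + k) w)))"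

lemma map_Suc_0_eqD:
  assumes "map Suc u @ 0 # map Suc v = map Suc u' @ 0 # map Suc v'"
  shows "u = u' \<and> v = v'"
proof -
  \<comment> \<open>Shifted letters are nonzero, so the first 0 marks the end of the prefix.\<close>
  have "takeWhile (\<lambda>a. a \<noteq> 0) (map Suc u @ 0 # map Suc v) = map Suc u" for u v
    by (subst takeWhile_append2) auto
  then have "map Suc u = map Suc u'"
    using assms by metis
  with assms show ?thesis
    by (simp add: inj_map_eq_map)
qed

lemma zero_word_split:
  assumes "distinct w" "set w = insert 0 (Suc ` B)"
  obtains u v where "w = map Suc u @ 0 # map Suc v" "distinct (u @ v)" "set (u @ v) = B"
proof -
  obtain p q where w: "w = p @ 0 # q"
    using assms(2) by (metis insertI1 split_list)
  have "set p \<union> set q = set w - {0}"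
    using assms(1) by (auto simp: w)
  then have "set p \<union> set q = Suc ` B"
    using assms(2) by auto
  then have "\<forall>a\<in>set p. \<exists>b. a = Suc b" "\<forall>a\<in>set q. \<exists>b. a = Suc b"
    by blast+
  then obtain u v where uv: "p = map Suc u" "q = map Suc v"
    unfolding ex_map_conv[symmetric] by blast
  show ?thesis
  proof
    show "w = map Suc u @ 0 # map Suc v"
      by (simp add: w uv)
    show "distinct (u @ v)"
      using assms(1) by (auto simp: w uv distinct_map)
    show "set (u @ v) = B"
      using \<open>set p \<union> set q = Suc ` B\<close> by (auto simp: uv image_Un[symmetric] inj_image_eq_iff)
  qed
qed

text \<open>The position of the block is the length of the prefix before 0, and block and remaining
  letters are stored separately, so the word can be reassembled. Conversely, cutting a word of the
  enlarged alphabet at its only 0 shows where the block has to be substituted.\<close>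

lemma bij_betw_collapse_block:
  assumes "k \<le> n"
  shows "bij_betw (collapse_block k) ({0..n - k} \<times> permutations_of_set {..<n})
    (SIGMA A:{A. A \<subseteq> {..<n} \<and> card A = k}. permutations_of_set A \<times>
      permutations_of_set (insert 0 (Suc ` ({..<n} - A))))"
proof (rule bij_betw_imageI)
  show "inj_on (collapse_block k) ({0..n - k} \<times> permutations_of_set {..<n})"
  proof (rule inj_onI, safe)
    fix l l' \<rho> \<rho>'
    assume *: "l \<in> {0..n - k}" "l' \<in> {0..n - k}" "\<rho> \<in> permutations_of_set {..<n}"
      "\<rho>' \<in> permutations_of_set {..<n}" "collapse_block k (l, \<rho>) = collapse_block k (l', \<rho>')"
    have len: "length \<rho> = n" "length \<rho>' = n"
      using * length_finite_permutations_of_set by fastforce+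
    have eqs: "take l \<rho> = take l' \<rho>'" "take k (drop l \<rho>) = take k (drop l' \<rho>')"
      "drop (l + k) \<rho> = drop (l' + k) \<rho>'"
      using *(5) map_Suc_0_eqD[of "take l \<rho>" "drop (l + k) \<rho>" "take l' \<rho>'" "drop (l' + k) \<rho>'"]
      by (auto simp: collapse_block_def)
    show "l = l'"
      using arg_cong[OF eqs(1), of length] * len by simp
    have "\<rho> = take l \<rho> @ take k (drop l \<rho>) @ drop (l + k) \<rho>" for l and \<rho> :: "nat list"
      by (metis add.commute append_take_drop_id drop_drop)
    then show "\<rho> = \<rho>'"
      using eqs by metis
  qed
next
  let ?T1 = "SIGMA A:{A. A \<subseteq> {..<n} \<and> card A = k}. permutations_of_set A \<times>
      permutations_of_set (insert 0 (Suc ` ({..<n} - A)))"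
  let ?T2 = "{0..n - k} \<times> permutations_of_set {..<n}"
  show "collapse_block k ` ?T2 = ?T1"
  proof (intro equalityI subsetI)
    fix t assume "t \<in> collapse_block k ` ?T2"
    then obtain l \<rho> where t: "t = collapse_block k (l, \<rho>)" and l: "l \<le> n - k"
      and \<rho>: "set \<rho> = {..<n}" "distinct \<rho>"
      by (auto simp: permutations_of_set_def)
    define u v w where uvw: "u = take l \<rho>" "v = take k (drop l \<rho>)" "w = drop (l + k) \<rho>"
    have cat: "\<rho> = u @ v @ w"
      unfolding uvw by (metis add.commute append_take_drop_id drop_drop)
    have "length \<rho> = n"
      using \<rho> by (metis card_lessThan distinct_card)
    then have v: "length v = k"
      using l assms by (simp add: uvw)
    have "set u \<union> set w = {..<n} - set v"
      using \<rho> unfolding cat by auto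
    then have "Suc ` set u \<union> Suc ` set w = Suc ` ({..<n} - set v)"
      by (metis image_Un)
    moreover have "distinct (map Suc u @ 0 # map Suc w)"
      using \<rho>(2) unfolding cat by (auto simp: distinct_map)
    ultimately show "t \<in> ?T1"
      using \<rho> v unfolding t collapse_block_def prod.case uvw[symmetric]
      by (auto simp: permutations_of_set_def distinct_card cat)
  next
    fix t assume "t \<in> ?T1"
    then obtain A v w where t: "t = (A, v, w)" and A: "A \<subseteq> {..<n}" "card A = k"
      and v: "set v = A" "distinct v"
      and w: "set w = insert 0 (Suc ` ({..<n} - A))" "distinct w"
      by (auto simp: permutations_of_set_def)
    obtain p q where pq: "w = map Suc p @ 0 # map Suc q" "distinct (p @ q)" "set (p @ q) = {..<n} - A"
      using zero_word_split[OF w(2,1)] .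
    have "length v = k"
      using v A by (metis distinct_card)
    then have t': "t = collapse_block k (length p, p @ v @ q)"
      using pq(1) v(1) by (simp add: t collapse_block_def)
    have \<rho>: "p @ v @ q \<in> permutations_of_set {..<n}"
      using pq v A by (auto simp: permutations_of_set_def)
    then have "length (p @ v @ q) = n"
      using length_finite_permutations_of_set by fastforce
    then have "length p \<in> {0..n - k}"
      using \<open>length v = k\<close> by simp
    with \<rho> t' show "t \<in> collapse_block k ` ?T2"
      by blast
  qed
qed


section \<open>The antisymmetrized brackets\<close>

text \<open>Turns a sum over a symmetric group into a sum over words in the alphabet
  \<open>A\<close>, so that a bracket of a subfamily of the arguments keeps the original
  labels.\<close>

lemma bij_betw_permute_list_sorted:
  assumes "finite A" "card A = k"
  shows "bij_betw (\<lambda>\<sigma>. permute_list \<sigma> (sorted_list_of_set A)) {\<sigma>. \<sigma> permutes {..<k}} (permutations_of_set A)"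
proof (rule bij_betw_imageI)
  let ?s = "sorted_list_of_set A"
  have len: "length ?s = k"
    using assms by simp
  show "inj_on (\<lambda>\<sigma>. permute_list \<sigma> ?s) {\<sigma>. \<sigma> permutes {..<k}}"
  proof (rule inj_onI)
    fix \<sigma> \<tau> assume *: "\<sigma> \<in> {\<sigma>. \<sigma> permutes {..<k}}" "\<tau> \<in> {\<sigma>. \<sigma> permutes {..<k}}"
      "permute_list \<sigma> ?s = permute_list \<tau> ?s"
    have "\<sigma> i = \<tau> i" for i
    proof (cases "i < k")
      case True
      then have "\<sigma> i < k" "\<tau> i < k"
        using * permutes_in_image[of _ "{..<k}" i] by auto
      moreover have "?s ! \<sigma> i = ?s ! \<tau> i"
        using * True len permute_list_nth[of \<sigma> ?s i] permute_list_nth[of \<tau> ?s i] by simp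
      ultimately show ?thesis
        using len distinct_sorted_list_of_set[of A] by (simp add: nth_eq_iff_index_eq)
    qed (use * in \<open>auto simp: permutes_not_in\<close>)
    then show "\<sigma> = \<tau>" ..
  qed
  show "(\<lambda>\<sigma>. permute_list \<sigma> ?s) ` {\<sigma>. \<sigma> permutes {..<k}} = permutations_of_set A"
  proof safe
    fix \<sigma> assume "\<sigma> permutes {..<k}"
    then show "permute_list \<sigma> ?s \<in> permutations_of_set A"
      using len assms(1) by (auto simp: permutations_of_set_def)
  next
    fix w assume "w \<in> permutations_of_set A"
    then have "mset w = mset ?s"
      using assms(1) by (auto simp: permutations_of_set_def set_eq_iff_mset_eq_distinct[symmetric])
    then obtain \<sigma> where "\<sigma> permutes {..<length ?s}" "permute_list \<sigma> ?s = w"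
      by (rule mset_eq_permutation)
    then show "w \<in> (\<lambda>\<sigma>. permute_list \<sigma> ?s) ` {\<sigma>. \<sigma> permutes {..<k}}"
      using len by auto
  qed
qed

text \<open>Reading off a sorted list is monotone, so a word of positions and the word of labels
  found there have the same inversions.\<close>

lemma chi_sorted:
  assumes "finite A" "\<sigma> permutes {..<card A}"
  shows "chi (map d (sorted_list_of_set A)) \<sigma> = chi_word d (permute_list \<sigma> (sorted_list_of_set A))"
proof -
  let ?s = "sorted_list_of_set A"
  have range: "set (map \<sigma> [0..<length ?s]) = {..<length ?s}"
    using permutes_image[OF assms(2)] assms(1) by (simp add: lessThan_atLeast0)
  have "chi (map d ?s) \<sigma> = chi_word (nth (map d ?s)) (map \<sigma> [0..<length ?s])"
    using assms chi_eq_chi_word[of \<sigma> "map d ?s"] by simp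
  also have "\<dots> = word_sign (\<lambda>a b. - msign (d (?s ! a) * d (?s ! b))) (map \<sigma> [0..<length ?s])"
    using range by (intro word_sign_cong) (simp del: set_map length_sorted_list_of_set)
  also have "\<dots> = chi_word d (map (nth ?s) (map \<sigma> [0..<length ?s]))"
  proof (rule word_sign_map[symmetric])
    show "strict_mono_on (set (map \<sigma> [0..<length ?s])) (nth ?s)"
      unfolding range using strict_sorted_list_of_set[of A]
      by (auto simp: strict_mono_on_def sorted_wrt_iff_nth_less)
  qed
  also have "map (nth ?s) (map \<sigma> [0..<length ?s]) = permute_list \<sigma> ?s"
    by (simp add: permute_list_def)
  finally show ?thesis .
qed

context graded_vector_space
begin

lemma permutations_tensors:
  assumes "w \<in> permutations_of_set A" "finite A" "card A = k" "\<And>a. a \<in> A \<Longrightarrow> x a \<in> carrier V"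
  shows "map x w \<in> tensors V k"
  using assms length_finite_permutations_of_set[of w A]
  by (auto simp: tensors_iff dest: permutations_of_setD)

text \<open>The form in which nested brackets are expanded: the alphabet is a set of labels for the
  inner bracket, and 0 together with the shifted remaining labels for the outer one.\<close>

lemma alternation_word:
  assumes f: "f \<in> tensor_maps R V k p" and A: "finite A" "card A = k"
    and x: "\<And>a. a \<in> A \<Longrightarrow> x a \<in> component V (d a)"
  shows "alternation k f (map x (sorted_list_of_set A))
    = (\<Oplus>\<^bsub>V\<^esub>w\<in>permutations_of_set A. [chi_word d w] \<cdot>\<^bsub>V\<^esub> f (map x w))"
proof -
  let ?s = "sorted_list_of_set A"
  have len: "length ?s = k"
    using A by simp
  have "homogeneous V (map d ?s) (map x ?s)"
    unfolding homogeneous_def list_all2_map1 list_all2_map2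
    using x A(1) by (intro list.rel_refl_strong) simp
  then have "alternation k f (map x ?s) = (\<Oplus>\<^bsub>V\<^esub>\<sigma>\<in>{\<sigma>. \<sigma> permutes {..<k}}.
      [chi (map d ?s) \<sigma>] \<cdot>\<^bsub>V\<^esub> f (permute_list \<sigma> (map x ?s)))"
    using len by (intro alternation_homogeneous[OF f]) auto
  also have "\<dots> = (\<Oplus>\<^bsub>V\<^esub>w\<in>permutations_of_set A. [chi_word d w] \<cdot>\<^bsub>V\<^esub> f (map x w))"
  proof (rule M.finsum_reindex_bij[OF bij_betw_permute_list_sorted[OF A]])
    fix w assume "w \<in> permutations_of_set A"
    then have "map x w \<in> tensors V k"
      using A x component_closed by (intro permutations_tensors) auto
    then show "[chi_word d w] \<cdot>\<^bsub>V\<^esub> f (map x w) \<in> carrier V"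
      using tensor_maps_closed[OF f] by simp
  next
    fix \<sigma> assume "\<sigma> \<in> {\<sigma>. \<sigma> permutes {..<k}}"
    then show "[chi (map d ?s) \<sigma>] \<cdot>\<^bsub>V\<^esub> f (permute_list \<sigma> (map x ?s))
        = [chi_word d (permute_list \<sigma> ?s)] \<cdot>\<^bsub>V\<^esub> f (map x (permute_list \<sigma> ?s))"
      using chi_sorted[OF A(1), of \<sigma> d] A len by (simp add: permute_list_map)
  qed
  finally show ?thesis .
qed

end

section \<open>The axioms of an L(m)-structure for the brackets\<close>

context A_structure
begin

abbreviation bracket :: "nat \<Rightarrow> 'v list \<Rightarrow> 'v" where
  "bracket \<equiv> antisymmetrization R m V \<mu>"

lemma mult_tensor_maps: "k \<in> arity_range m \<Longrightarrow> \<mu> k \<in> tensor_maps R V k (int k - 2)"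
  using maps by auto

lemma bracket_eq: "k \<in> arity_range m \<Longrightarrow> bracket k = alternation k (\<mu> k)"
  using mult_tensor_maps by (intro antisymmetrization_eq_alternation)

lemma bracket_tensor_maps: "k \<in> arity_range m \<Longrightarrow> bracket k \<in> tensor_maps R V k (int k - 2)"
  by (simp add: bracket_eq alternation_tensor_maps mult_tensor_maps)

lemma bracket_homogeneous:
  "k \<in> arity_range m \<Longrightarrow> length xs = k \<Longrightarrow> homogeneous V ds xs \<Longrightarrow>
    bracket k xs = (\<Oplus>\<^bsub>V\<^esub>\<sigma>\<in>{\<sigma>. \<sigma> permutes {..<k}}. [chi ds \<sigma>] \<cdot>\<^bsub>V\<^esub> \<mu> k (permute_list \<sigma> xs))"
  by (simp add: bracket_eq alternation_homogeneous[OF mult_tensor_maps])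

lemma bracket_word:
  assumes "k \<in> arity_range m" "finite A" "card A = k" "\<And>a. a \<in> A \<Longrightarrow> x a \<in> component V (d a)"
  shows "bracket k (map x (sorted_list_of_set A))
    = (\<Oplus>\<^bsub>V\<^esub>w\<in>permutations_of_set A. [chi_word d w] \<cdot>\<^bsub>V\<^esub> \<mu> k (map x w))"
  using assms by (simp add: bracket_eq alternation_word[OF mult_tensor_maps])

text \<open>Replacing \<tau> by \<sigma> \<circ> \<tau> permutes the summands, and the cocycle rule
  \<open>chi_compose\<close> splits off the constant factor.\<close>

lemma bracket_antisymmetric:
  assumes k: "k \<in> arity_range m" and len: "length xs = k" and hom: "homogeneous V ds xs"
    and \<sigma>: "\<sigma> permutes {..<k}"
  shows "bracket k (permute_list \<sigma> xs) = [chi ds \<sigma>] \<cdot>\<^bsub>V\<^esub> bracket k xs"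
proof -
  let ?S = "{\<tau>. \<tau> permutes {..<k}}"
  have lends: "length ds = k"
    using hom len by (auto simp: homogeneous_def dest: list_all2_lengthD)
  have closed: "\<mu> k (permute_list \<tau> xs) \<in> carrier V" if "\<tau> permutes {..<k}" for \<tau>
    using tensor_maps_closed[OF mult_tensor_maps[OF k] tensors_permute_list[OF that homogeneous_tensors]]
      len hom by blast
  \<comment> \<open>The cocycle rule has to be solved for the sign of \<tau>, which requires the
    sign of \<sigma> to be its own inverse.\<close>
  have chi_sq: "chi ds \<sigma> * chi ds \<sigma> = 1"
    using chi_word_cases[of "nth ds" "map \<sigma> [0..<k]"] \<sigma> lends by (auto simp: chi_eq_chi_word)
  have "bracket k (permute_list \<sigma> xs) = (\<Oplus>\<^bsub>V\<^esub>\<tau>\<in>?S. [chi (permute_list \<sigma> ds) \<tau>] \<cdot>\<^bsub>V\<^esub>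
      \<mu> k (permute_list \<tau> (permute_list \<sigma> xs)))"
    using homogeneous_permute_list[OF hom] \<sigma> len k by (intro bracket_homogeneous) auto
  also have "\<dots> = (\<Oplus>\<^bsub>V\<^esub>\<tau>\<in>?S. [chi ds \<sigma>] \<cdot>\<^bsub>V\<^esub> ([chi ds (\<sigma> \<circ> \<tau>)] \<cdot>\<^bsub>V\<^esub> \<mu> k (permute_list (\<sigma> \<circ> \<tau>) xs)))"
  proof (rule M.finsum_cong')
    fix \<tau> assume "\<tau> \<in> ?S"
    then have \<tau>: "\<tau> permutes {..<k}" and \<sigma>\<tau>: "\<sigma> \<circ> \<tau> permutes {..<k}"
      using \<sigma> permutes_compose by auto
    have "chi (permute_list \<sigma> ds) \<tau> = chi ds \<sigma> * chi ds (\<sigma> \<circ> \<tau>)"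
      using chi_compose[of \<sigma> ds \<tau>] \<sigma> \<tau> lends chi_sq by (simp add: mult.assoc[symmetric])
    then show "[chi (permute_list \<sigma> ds) \<tau>] \<cdot>\<^bsub>V\<^esub> \<mu> k (permute_list \<tau> (permute_list \<sigma> xs))
        = [chi ds \<sigma>] \<cdot>\<^bsub>V\<^esub> ([chi ds (\<sigma> \<circ> \<tau>)] \<cdot>\<^bsub>V\<^esub> \<mu> k (permute_list (\<sigma> \<circ> \<tau>) xs))"
      using \<tau> len closed[OF \<sigma>\<tau>] by (simp add: permute_list_compose M.add_pow_mult)
  qed (use closed permutes_compose[OF _ \<sigma>] in auto)
  also have "\<dots> = [chi ds \<sigma>] \<cdot>\<^bsub>V\<^esub> (\<Oplus>\<^bsub>V\<^esub>\<tau>\<in>?S. [chi ds (\<sigma> \<circ> \<tau>)] \<cdot>\<^bsub>V\<^esub> \<mu> k (permute_list (\<sigma> \<circ> \<tau>) xs))"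
    using closed permutes_compose[OF _ \<sigma>] by (intro M.add_pow_finsum[symmetric]) auto
  also have "(\<Oplus>\<^bsub>V\<^esub>\<tau>\<in>?S. [chi ds (\<sigma> \<circ> \<tau>)] \<cdot>\<^bsub>V\<^esub> \<mu> k (permute_list (\<sigma> \<circ> \<tau>) xs))
      = (\<Oplus>\<^bsub>V\<^esub>\<tau>\<in>?S. [chi ds \<tau>] \<cdot>\<^bsub>V\<^esub> \<mu> k (permute_list \<tau> xs))"
  proof (rule M.finsum_reindex_bij[where h = "(\<circ>) \<sigma>"])
    show "bij_betw ((\<circ>) \<sigma>) ?S ?S"
      by (rule bij_betw_byWitness[where f' = "(\<circ>) (inv_into UNIV \<sigma>)"])
        (use \<sigma> permutes_inv[OF \<sigma>] permutes_compose in \<open>auto simp: o_assoc permutes_inv_o\<close>)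
  qed (use closed in auto)
  also have "\<dots> = bracket k xs"
    using bracket_homogeneous[OF k len hom] ..
  finally show ?thesis .
qed

lemma arity_range_le: "n \<in> arity_range m \<Longrightarrow> k \<in> {1..n} \<Longrightarrow> k \<in> arity_range m"
  by (auto simp: arity_range_def intro: order_trans[rotated])

text \<open>\<open>case_nat y x\<close> evaluates letters: 0 stands for the inner value
  \<open>y\<close>, and \<open>Suc a\<close> for the original argument \<open>x a\<close>. Closure
  is stated separately because it is a side condition of the rearrangements of \<open>finsum\<close>
  below.\<close>

lemma nested_mult_closed:
  assumes n: "n \<in> arity_range m" and k: "k \<in> {1..n}" and A: "A \<subseteq> {..<n}" "card A = k"
    and x: "\<And>a. a < n \<Longrightarrow> x a \<in> carrier V"
    and v: "v \<in> permutations_of_set A" and w: "w \<in> permutations_of_set (insert 0 (Suc ` ({..<n} - A)))"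
  shows "\<mu> (n - k + 1) (map (case_nat (\<mu> k (map x v)) x) w) \<in> carrier V"
proof -
  have fin: "finite A" "finite ({..<n} - A)" "card ({..<n} - A) = n - k"
    using A finite_subset[OF A(1)] by (auto simp: card_Diff_subset)
  have "map x v \<in> tensors V k"
    using A fin x by (intro permutations_tensors[OF v]) auto
  then have "\<mu> k (map x v) \<in> carrier V"
    using tensor_maps_closed[OF mult_tensor_maps[OF arity_range_le[OF n k]]] by blast
  then have "map (case_nat (\<mu> k (map x v)) x) w \<in> tensors V (n - k + 1)"
    using fin x by (intro permutations_tensors[OF w]) (auto simp: card_image)
  moreover have "n - k + 1 \<in> arity_range m"
    using k by (intro arity_range_le[OF n]) auto
  ultimately show ?thesis
    using tensor_maps_closed[OF mult_tensor_maps] by blast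
qed

text \<open>The inner bracket expands over words in \<open>A\<close>, and additivity of the outer
  bracket in its first slot pulls that sum out. Each value of \<mu>_k is then homogeneous of degree
  \<open>sum_list (map d v) + int k - 2\<close>, which is the degree that the letter 0 receives when
  the outer bracket is expanded.\<close>

lemma bracket_nested:
  assumes n: "n \<in> arity_range m" and k: "k \<in> {1..n}" and A: "A \<subseteq> {..<n}" "card A = k"
    and x: "\<And>a. a < n \<Longrightarrow> x a \<in> component V (d a)"
  shows "bracket (n - k + 1) (bracket k (map x (sorted_list_of_set A))
      # map x (sorted_list_of_set ({..<n} - A)))
    = (\<Oplus>\<^bsub>V\<^esub>v\<in>permutations_of_set A. \<Oplus>\<^bsub>V\<^esub>w\<in>permutations_of_set (insert 0 (Suc ` ({..<n} - A))).
        [(chi_word d v * chi_word (case_nat (sum_list (map d v) + int k - 2) d) w)] \<cdot>\<^bsub>V\<^esub>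
          \<mu> (n - k + 1) (map (case_nat (\<mu> k (map x v)) x) w))"
proof -
  define j where "j = n - k + 1"
  let ?B = "{..<n} - A"
  let ?C = "insert 0 (Suc ` ?B)" and ?t = "sorted_list_of_set ({..<n} - A)"
  have ar: "k \<in> arity_range m" "j \<in> arity_range m"
    using k by (auto simp: j_def intro!: arity_range_le[OF n])
  have fin: "finite A" "finite ?B" "card ?B = n - k"
    using A finite_subset[OF A(1)] by (auto simp: card_Diff_subset)
  have xc: "x a \<in> carrier V" if "a < n" for a
    using x[OF that] component_closed by blast
  have C: "finite ?C" "card ?C = j"
    using fin by (auto simp: card_image j_def)
  \<comment> \<open>Since 0 is the least letter, the sorted word of the enlarged alphabet puts the
    inner value in front, as the nested bracket does.\<close>
  have sC: "sorted_list_of_set ?C = 0 # map Suc ?t"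
  proof -
    have "sorted_wrt (<) (0 # map Suc ?t)"
      using strict_sorted_list_of_set[of ?B] by (simp add: sorted_wrt_map)
    moreover have "set (0 # map Suc ?t) = ?C"
      using fin by simp
    ultimately show ?thesis
      by (metis sorted_list_of_set.idem_if_sorted_distinct strict_sorted_iff)
  qed
  have v: "map x v \<in> tensors V k" "\<mu> k (map x v) \<in> component V (sum_list (map d v) + int k - 2)"
    if "v \<in> permutations_of_set A" for v
  proof -
    show t: "map x v \<in> tensors V k"
      using A fin xc by (intro permutations_tensors[OF that]) auto
    have "homogeneous V (map d v) (map x v)"
      unfolding homogeneous_def list_all2_map1 list_all2_map2
      using x A(1) permutations_of_setD(1)[OF that] by (intro list.rel_refl_strong) auto
    then show "\<mu> k (map x v) \<in> component V (sum_list (map d v) + int k - 2)"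
      using tensor_maps_degree[OF mult_tensor_maps[OF ar(1)]] t by (simp add: tensors_iff add_diff_eq)
  qed
  have muc: "\<mu> k (map x v) \<in> carrier V" if "v \<in> permutations_of_set A" for v
    using component_closed v(2)[OF that] .
  have ts: "\<zero>\<^bsub>V\<^esub> # map x ?t \<in> tensors V j"
    using fin xc by (auto simp: tensors_iff j_def)
  \<comment> \<open>The zero in slot 0 is a placeholder; the homomorphism is the dependence on
    whatever replaces it.\<close>
  interpret slot: abelian_group_hom V V "\<lambda>y. bracket j ((\<zero>\<^bsub>V\<^esub> # map x ?t)[0 := y])"
    using ts by (intro M.abelian_group_axioms
        multiadditive_slot_hom[OF tensor_maps_multiadditive[OF bracket_tensor_maps[OF ar(2)]]])
      (simp_all add: tensors_iff j_def)
  have inner: "bracket j (\<mu> k (map x v) # map x ?t)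
      = (\<Oplus>\<^bsub>V\<^esub>w\<in>permutations_of_set ?C. [chi_word (case_nat (sum_list (map d v) + int k - 2) d) w] \<cdot>\<^bsub>V\<^esub>
          \<mu> j (map (case_nat (\<mu> k (map x v)) x) w))"
    if "v \<in> permutations_of_set A" for v
  proof -
    let ?x = "case_nat (\<mu> k (map x v)) x" and ?d = "case_nat (sum_list (map d v) + int k - 2) d"
    have "bracket j (map ?x (sorted_list_of_set ?C))
        = (\<Oplus>\<^bsub>V\<^esub>w\<in>permutations_of_set ?C. [chi_word ?d w] \<cdot>\<^bsub>V\<^esub> \<mu> j (map ?x w))"
      using x v(2)[OF that] by (intro bracket_word[OF ar(2) C]) auto
    then show ?thesis
      unfolding sC by (simp add: o_def)
  qed
  have closed: "\<mu> j (map (case_nat (\<mu> k (map x v)) x) w) \<in> carrier V"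
    if "v \<in> permutations_of_set A" "w \<in> permutations_of_set ?C" for v w
    unfolding j_def using nested_mult_closed[OF n k A xc that] .
  have "bracket j (bracket k (map x (sorted_list_of_set A)) # map x ?t)
    = bracket j ((\<zero>\<^bsub>V\<^esub> # map x ?t)[0 := \<Oplus>\<^bsub>V\<^esub>v\<in>permutations_of_set A. [chi_word d v] \<cdot>\<^bsub>V\<^esub> \<mu> k (map x v)])"
    using A x by (subst bracket_word[OF ar(1) fin(1)]) auto
  also have "\<dots> = (\<Oplus>\<^bsub>V\<^esub>v\<in>permutations_of_set A. [chi_word d v] \<cdot>\<^bsub>V\<^esub> bracket j (\<mu> k (map x v) # map x ?t))"
    using muc slot.hom_closed
    by (subst slot.hom_finsum) (auto intro!: M.finsum_cong' simp: slot.hom_add_pow_int[simplified])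
  also have "\<dots> = (\<Oplus>\<^bsub>V\<^esub>v\<in>permutations_of_set A. \<Oplus>\<^bsub>V\<^esub>w\<in>permutations_of_set ?C.
        [(chi_word d v * chi_word (case_nat (sum_list (map d v) + int k - 2) d) w)] \<cdot>\<^bsub>V\<^esub>
          \<mu> j (map (case_nat (\<mu> k (map x v)) x) w))"
  proof (rule M.finsum_cong')
    fix v assume v: "v \<in> permutations_of_set A"
    show "[chi_word d v] \<cdot>\<^bsub>V\<^esub> bracket j (\<mu> k (map x v) # map x ?t)
      = (\<Oplus>\<^bsub>V\<^esub>w\<in>permutations_of_set ?C.
        [(chi_word d v * chi_word (case_nat (sum_list (map d v) + int k - 2) d) w)] \<cdot>\<^bsub>V\<^esub>
          \<mu> j (map (case_nat (\<mu> k (map x v)) x) w))"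
      unfolding inner[OF v] using closed[OF v]
      by (subst M.add_pow_finsum) (auto simp: M.add_pow_mult intro!: M.finsum_cong')
  qed (use closed in \<open>auto intro!: M.finsum_closed\<close>)
  finally show ?thesis
    unfolding j_def .
qed

text \<open>The inner arity \<open>k\<close> is fixed here. The index passes from unshuffles to
  subsets \<open>A\<close>, then to triples of a subset and two words, and back along
  \<open>collapse_block\<close> to a block position with a word \<rho>;
  \<open>chi_word_block\<close> matches the signs. The factor of \<rho> is kept apart from the
  A(m)-sign because it does not depend on \<open>k\<close> or the position.\<close>

lemma bracket_identity_arity:
  assumes n: "n \<in> arity_range m" and k: "k \<in> {1..n}" and len: "length xs = n"
    and hom: "homogeneous V ds xs"
  shows "(\<Oplus>\<^bsub>V\<^esub>\<sigma>\<in>unshuffles k n. [(chi ds \<sigma> * msign (int k * (int (n - k + 1) - 1)))] \<cdot>\<^bsub>V\<^esub>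
      bracket (n - k + 1) (bracket k (take k (permute_list \<sigma> xs)) # drop k (permute_list \<sigma> xs)))
    = finsum V (\<lambda>(l, \<rho>). [chi_word (nth ds) \<rho>] \<cdot>\<^bsub>V\<^esub>
        ([msign (int k + int l + int k * int l + int n * int k
            + int k * sum_list (take l (map (nth ds) \<rho>)))] \<cdot>\<^bsub>V\<^esub>
          \<mu> (n - k + 1) (take l (map (nth xs) \<rho>) @ [\<mu> k (take k (drop l (map (nth xs) \<rho>)))]
            @ drop (l + k) (map (nth xs) \<rho>))))
      ({0..n - k} \<times> permutations_of_set {..<n})"
proof -
  define j where "j = n - k + 1"
  let ?d = "nth ds" and ?x = "nth xs"
  let ?T = "{A. A \<subseteq> {..<n} \<and> card A = k}"
  let ?C = "\<lambda>A. insert 0 (Suc ` ({..<n} - A))"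
  let ?s = "\<lambda>A. sorted_list_of_set A" and ?t = "\<lambda>A. sorted_list_of_set ({..<n} - A)"
  let ?M = "msign (int k * (int j - 1))"
  let ?e = "\<lambda>v. sum_list (map ?d v) + int k - 2"
  have lends: "length ds = n"
    using hom len by (auto simp: homogeneous_def dest: list_all2_lengthD)
  have x: "?x a \<in> component V (?d a)" if "a < n" for a
    using hom that lends by (simp add: homogeneous_def list_all2_conv_all_nth)
  have xc: "?x a \<in> carrier V" if "a < n" for a
    using x[OF that] component_closed by blast
  have fin: "finite ?T" "\<And>A. finite (?C A)"
    by auto
  have ar: "k \<in> arity_range m" "j \<in> arity_range m"
    using k by (auto simp: j_def intro!: arity_range_le[OF n])
  have nested: "\<mu> j (map (case_nat (\<mu> k (map ?x v)) ?x) w) \<in> carrier V"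
    if "A \<in> ?T" "v \<in> permutations_of_set A" "w \<in> permutations_of_set (?C A)" for A v w
    unfolding j_def using that by (intro nested_mult_closed[OF n k]) (auto simp: xc)
  have bracket_closed: "bracket j (bracket k (map ?x (?s A)) # map ?x (?t A)) \<in> carrier V"
    if "A \<in> ?T" for A
  proof -
    have A: "finite A" "A \<subseteq> {..<n}" "card A = k" "card ({..<n} - A) = n - k"
      using that finite_subset[of A "{..<n}"] by (auto simp: card_Diff_subset)
    then have "map ?x (?s A) \<in> tensors V k"
      using xc by (auto simp: tensors_iff)
    then have "bracket k (map ?x (?s A)) # map ?x (?t A) \<in> tensors V j"
      using A xc tensor_maps_closed[OF bracket_tensor_maps[OF ar(1)]] by (auto simp: tensors_iff j_def)
    then show ?thesis
      using tensor_maps_closed[OF bracket_tensor_maps[OF ar(2)]] by blast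
  qed
  have "(\<Oplus>\<^bsub>V\<^esub>\<sigma>\<in>unshuffles k n. [(chi ds \<sigma> * ?M)] \<cdot>\<^bsub>V\<^esub>
      bracket j (bracket k (take k (permute_list \<sigma> xs)) # drop k (permute_list \<sigma> xs)))
    = (\<Oplus>\<^bsub>V\<^esub>A\<in>?T. [(chi_word ?d (?s A @ ?t A) * ?M)] \<cdot>\<^bsub>V\<^esub>
        bracket j (bracket k (map ?x (?s A)) # map ?x (?t A)))"
  proof (rule M.finsum_reindex_bij[OF bij_betw_unshuffles])
    fix \<sigma> assume \<sigma>: "\<sigma> \<in> unshuffles k n"
    have upt: "[0..<n] = [0..<k] @ [k..<n]"
      using k upt_add_eq_append[of 0 k "n - k"] by simp
    have split: "map \<sigma> [0..<n] = ?s (\<sigma> ` {..<k}) @ ?t (\<sigma> ` {..<k})"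
      using k unfolding upt map_append by (simp add: unshuffle_sorted[OF \<sigma>])
    have "length (?s (\<sigma> ` {..<k})) = k"
      using k unshuffle_sorted(1)[OF \<sigma>] by (metis atLeastAtMost_iff diff_zero length_map length_upt)
    moreover have "permute_list \<sigma> xs = map ?x (map \<sigma> [0..<n])"
      using len by (simp add: permute_list_def)
    ultimately have "take k (permute_list \<sigma> xs) = map ?x (?s (\<sigma> ` {..<k}))"
      "drop k (permute_list \<sigma> xs) = map ?x (?t (\<sigma> ` {..<k}))"
      unfolding split by simp_all
    moreover have "chi ds \<sigma> = chi_word ?d (map \<sigma> [0..<n])"
      using \<sigma> lends chi_eq_chi_word[of \<sigma> ds] by (auto simp: unshuffles_def)
    ultimately show "[(chi ds \<sigma> * ?M)] \<cdot>\<^bsub>V\<^esub>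
        bracket j (bracket k (take k (permute_list \<sigma> xs)) # drop k (permute_list \<sigma> xs))
      = [(chi_word ?d (?s (\<sigma> ` {..<k}) @ ?t (\<sigma> ` {..<k})) * ?M)] \<cdot>\<^bsub>V\<^esub>
        bracket j (bracket k (map ?x (?s (\<sigma> ` {..<k}))) # map ?x (?t (\<sigma> ` {..<k})))"
      unfolding split by simp
  qed (use k bracket_closed in auto)
  also have "\<dots> = (\<Oplus>\<^bsub>V\<^esub>A\<in>?T. finsum V (\<lambda>(v, w). [(chi_word ?d (?s A @ ?t A) * ?M
        * chi_word ?d v * chi_word (case_nat (?e v) ?d) w)] \<cdot>\<^bsub>V\<^esub>
          \<mu> j (map (case_nat (\<mu> k (map ?x v)) ?x) w)) (permutations_of_set A \<times> permutations_of_set (?C A)))"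
  proof (rule M.finsum_cong')
    fix A assume A: "A \<in> ?T"
    have "bracket j (bracket k (map ?x (?s A)) # map ?x (?t A))
      = (\<Oplus>\<^bsub>V\<^esub>v\<in>permutations_of_set A. \<Oplus>\<^bsub>V\<^esub>w\<in>permutations_of_set (?C A).
          [(chi_word ?d v * chi_word (case_nat (?e v) ?d) w)] \<cdot>\<^bsub>V\<^esub>
            \<mu> j (map (case_nat (\<mu> k (map ?x v)) ?x) w))"
      unfolding j_def using A x by (intro bracket_nested[OF n k]) auto
    also have "\<dots> = finsum V (\<lambda>(v, w). [(chi_word ?d v * chi_word (case_nat (?e v) ?d) w)] \<cdot>\<^bsub>V\<^esub>
            \<mu> j (map (case_nat (\<mu> k (map ?x v)) ?x) w)) (permutations_of_set A \<times> permutations_of_set (?C A))"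
      using nested[OF A] by (intro M.finsum_Sigma) auto
    finally have eq: "bracket j (bracket k (map ?x (?s A)) # map ?x (?t A)) = \<dots>" .
    show "[(chi_word ?d (?s A @ ?t A) * ?M)] \<cdot>\<^bsub>V\<^esub> bracket j (bracket k (map ?x (?s A)) # map ?x (?t A))
      = finsum V (\<lambda>(v, w). [(chi_word ?d (?s A @ ?t A) * ?M
        * chi_word ?d v * chi_word (case_nat (?e v) ?d) w)] \<cdot>\<^bsub>V\<^esub>
          \<mu> j (map (case_nat (\<mu> k (map ?x v)) ?x) w)) (permutations_of_set A \<times> permutations_of_set (?C A))"
      unfolding eq
      using nested[OF A]
      by (subst M.add_pow_finsum) (auto simp: mult.assoc M.add_pow_mult[symmetric] intro!: M.finsum_cong')
  qed (use nested in \<open>auto intro!: M.finsum_closed\<close>)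
  also have "\<dots> = finsum V (\<lambda>(A, v, w). [(chi_word ?d (?s A @ ?t A) * ?M
        * chi_word ?d v * chi_word (case_nat (?e v) ?d) w)] \<cdot>\<^bsub>V\<^esub>
          \<mu> j (map (case_nat (\<mu> k (map ?x v)) ?x) w))
        (SIGMA A:?T. permutations_of_set A \<times> permutations_of_set (?C A))"
    using nested fin by (subst M.finsum_Sigma) (auto intro!: M.finsum_cong')
  also have "\<dots> = finsum V (\<lambda>(l, \<rho>). [chi_word ?d \<rho>] \<cdot>\<^bsub>V\<^esub>
        ([msign (int k + int l + int k * int l + int n * int k
            + int k * sum_list (take l (map ?d \<rho>)))] \<cdot>\<^bsub>V\<^esub>
          \<mu> j (take l (map ?x \<rho>) @ [\<mu> k (take k (drop l (map ?x \<rho>)))] @ drop (l + k) (map ?x \<rho>))))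
      ({0..n - k} \<times> permutations_of_set {..<n})"
  proof (rule M.finsum_reindex_bij[OF bij_betw_collapse_block, symmetric])
    fix p assume p: "p \<in> {0..n - k} \<times> permutations_of_set {..<n}"
    obtain l \<rho> where p': "p = (l, \<rho>)"
      by fastforce
    have l: "l \<le> n - k" and \<rho>: "set \<rho> = {..<n}" "distinct \<rho>"
      using p by (auto simp: p' permutations_of_set_def)
    define u v w where uvw: "u = take l \<rho>" "v = take k (drop l \<rho>)" "w = drop (l + k) \<rho>"
    have cat: "\<rho> = u @ v @ w"
      unfolding uvw by (metis add.commute append_take_drop_id drop_drop)
    have len\<rho>: "length \<rho> = n"
      using \<rho> by (metis card_lessThan distinct_card)
    have lens: "length u = l" "length v = k"
      using l k len\<rho> by (auto simp: uvw)
    have sets: "set u \<inter> set v = {}" "{..<n} - set v = set (u @ w)" "distinct v" "distinct (u @ w)"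
      using \<rho> unfolding cat by auto
    have block: "collapse_block k (l, \<rho>) = (set v, v, map Suc u @ 0 # map Suc w)"
      by (simp add: collapse_block_def uvw)
    have closed: "\<mu> j (map ?x u @ [\<mu> k (map ?x v)] @ map ?x w) \<in> carrier V"
    proof -
      have "collapse_block k p \<in> (SIGMA A:?T. permutations_of_set A \<times> permutations_of_set (?C A))"
        using bij_betw_collapse_block[of k n] p k by (auto simp: bij_betw_def)
      then have "\<mu> j (map (case_nat (\<mu> k (map ?x v)) ?x) (map Suc u @ 0 # map Suc w)) \<in> carrier V"
        unfolding p' block using nested by blast
      then show ?thesis
        by (simp add: o_def)
    qed
    have sort: "mset (sorted_list_of_set (set ys)) = mset ys" if "distinct ys" for ys :: "nat list"
      using set_eq_iff_mset_eq_distinct[of "sorted_list_of_set (set ys)" ys] that by simp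
    have mset: "mset (?s (set v)) = mset v" "mset (?t (set v)) = mset (u @ w)"
      using sort[OF sets(3)] sort[OF sets(4)] sets(2) by simp_all
    have sgn: "chi_word ?d (?s (set v) @ ?t (set v)) * ?M * chi_word ?d v
        * chi_word (case_nat (?e v) ?d) (map Suc u @ 0 # map Suc w)
      = chi_word ?d \<rho> * msign (int k + int l + int k * int l + int n * int k + int k * sum_list (map ?d u))"
      unfolding j_def cat lens(1)[symmetric]
      using sets(1) mset lens(2) len\<rho> by (intro chi_word_block) (auto simp: cat)
    show "(case p of (l, \<rho>) \<Rightarrow> [chi_word ?d \<rho>] \<cdot>\<^bsub>V\<^esub>
        ([msign (int k + int l + int k * int l + int n * int k
            + int k * sum_list (take l (map ?d \<rho>)))] \<cdot>\<^bsub>V\<^esub>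
          \<mu> j (take l (map ?x \<rho>) @ [\<mu> k (take k (drop l (map ?x \<rho>)))] @ drop (l + k) (map ?x \<rho>))))
      = (case collapse_block k p of (A, v, w) \<Rightarrow> [(chi_word ?d (?s A @ ?t A) * ?M
        * chi_word ?d v * chi_word (case_nat (?e v) ?d) w)] \<cdot>\<^bsub>V\<^esub>
          \<mu> j (map (case_nat (\<mu> k (map ?x v)) ?x) w))"
      unfolding p' block prod.case sgn take_map drop_map uvw[symmetric]
      using closed by (simp add: M.add_pow_mult o_def)
  qed (use k nested in auto)
  finally show ?thesis
    unfolding j_def .
qed

text \<open>The expansion of the brackets has \<open>k\<close> outermost and \<rho> inside, whereas
  the A(m)-identity concerns a single order of the arguments and has the position outermost.
  Exchanging the sums leaves, for every \<rho>, a sign times one instance of that identity.\<close>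

lemma bracket_identity:
  assumes n: "n \<in> arity_range m" and len: "length xs = n" and hom: "homogeneous V ds xs"
  shows "finsum V (\<lambda>(i, j). \<Oplus>\<^bsub>V\<^esub>\<sigma>\<in>unshuffles i n.
      [(chi ds \<sigma> * msign (int i * (int j - 1)))] \<cdot>\<^bsub>V\<^esub>
        bracket j (bracket i (take i (permute_list \<sigma> xs)) # drop i (permute_list \<sigma> xs)))
    {(i, j). 1 \<le> i \<and> 1 \<le> j \<and> i + j = n + 1} = \<zero>\<^bsub>V\<^esub>"
proof -
  let ?d = "nth ds" and ?x = "nth xs"
  let ?P = "permutations_of_set {..<n}"
  define t where "t \<rho> l k = [msign (int k + int l + int k * int l + int n * int k
      + int k * sum_list (take l (map ?d \<rho>)))] \<cdot>\<^bsub>V\<^esub>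
    \<mu> (n - k + 1) (take l (map ?x \<rho>) @ [\<mu> k (take k (drop l (map ?x \<rho>)))] @ drop (l + k) (map ?x \<rho>))"
    for \<rho> l k
  let ?F = "\<lambda>i j. \<Oplus>\<^bsub>V\<^esub>\<sigma>\<in>unshuffles i n. [(chi ds \<sigma> * msign (int i * (int j - 1)))] \<cdot>\<^bsub>V\<^esub>
      bracket j (bracket i (take i (permute_list \<sigma> xs)) # drop i (permute_list \<sigma> xs))"
  have lends: "length ds = n"
    using hom len by (auto simp: homogeneous_def dest: list_all2_lengthD)
  have xs: "?x a \<in> component V (?d a)" if "a < n" for a
    using hom that lends by (simp add: homogeneous_def list_all2_conv_all_nth)
  have hom\<rho>: "homogeneous V (map ?d \<rho>) (map ?x \<rho>)" and len\<rho>: "length \<rho> = n" if "\<rho> \<in> ?P" for \<rho>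
  proof -
    show "homogeneous V (map ?d \<rho>) (map ?x \<rho>)"
      unfolding homogeneous_def list_all2_map1 list_all2_map2
      using xs permutations_of_setD(1)[OF that] by (intro list.rel_refl_strong) auto
    show "length \<rho> = n"
      using length_finite_permutations_of_set[OF that] by simp
  qed
  have t_closed: "t \<rho> l k \<in> carrier V" if "\<rho> \<in> ?P" "k \<in> {1..n}" "l \<in> {0..n - k}" for \<rho> l k
  proof -
    have sub: "set (map ?x \<rho>) \<subseteq> carrier V"
      using homogeneous_tensors[OF hom\<rho>[OF that(1)]] len\<rho>[OF that(1)] by (auto simp: tensors_iff)
    then have "take k (drop l (map ?x \<rho>)) \<in> tensors V k"
      using len\<rho>[OF that(1)] that by (auto simp: tensors_iff dest!: in_set_takeD in_set_dropD)
    then have "\<mu> k (take k (drop l (map ?x \<rho>))) \<in> carrier V"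
      using tensor_maps_closed[OF mult_tensor_maps[OF arity_range_le[OF n that(2)]]] by blast
    then have "take l (map ?x \<rho>) @ [\<mu> k (take k (drop l (map ?x \<rho>)))] @ drop (l + k) (map ?x \<rho>)
        \<in> tensors V (n - k + 1)"
      using len\<rho>[OF that(1)] that sub by (auto simp: tensors_iff dest!: in_set_takeD in_set_dropD)
    moreover have "n - k + 1 \<in> arity_range m"
      using that by (intro arity_range_le[OF n]) auto
    ultimately show ?thesis
      unfolding t_def using tensor_maps_closed[OF mult_tensor_maps] by (intro M.add.int_pow_closed) blast
  qed
  have vanish: "(\<Oplus>\<^bsub>V\<^esub>l\<in>{0..n - 1}. \<Oplus>\<^bsub>V\<^esub>k\<in>{1..n - l}. t \<rho> l k) = \<zero>\<^bsub>V\<^esub>" if "\<rho> \<in> ?P" for \<rho>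
    unfolding t_def using identity[OF n _ hom\<rho>[OF that]] len\<rho>[OF that] by simp
  let ?U = "SIGMA l:{0..n - 1}. {1..n - l}"
  have finU: "finite ?U"
    by simp
  have tU_closed: "t \<rho> (fst p) (snd p) \<in> carrier V" if "\<rho> \<in> ?P" "p \<in> ?U" for \<rho> p
    using that(2) by (intro t_closed[OF that(1)]) auto
  have "finsum V (\<lambda>(i, j). ?F i j) {(i, j). 1 \<le> i \<and> 1 \<le> j \<and> i + j = n + 1}
      = (\<Oplus>\<^bsub>V\<^esub>k\<in>{1..n}. ?F k (n - k + 1))"
  proof (rule M.finsum_reindex_bij[symmetric])
    show "bij_betw (\<lambda>k. (k, n - k + 1)) {1..n} {(i, j). 1 \<le> i \<and> 1 \<le> j \<and> i + j = n + 1}"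
      by (rule bij_betw_byWitness[where f' = fst]) auto
  next
    fix p assume "p \<in> {(i, j). 1 \<le> i \<and> 1 \<le> j \<and> i + j = n + 1}"
    then obtain k j where "p = (k, j)" "1 \<le> k" "1 \<le> j" "k + j = n + 1"
      by blast
    then have k: "k \<in> {1..n}" "p = (k, n - k + 1)"
      by auto
    show "(case p of (i, j) \<Rightarrow> ?F i j) \<in> carrier V"
      unfolding k(2) prod.case bracket_identity_arity[OF n k(1) len hom] t_def[symmetric]
      using t_closed k(1) by (intro M.finsum_closed) auto
  qed simp
  also have "\<dots> = (\<Oplus>\<^bsub>V\<^esub>k\<in>{1..n}. \<Oplus>\<^bsub>V\<^esub>l\<in>{0..n - k}. \<Oplus>\<^bsub>V\<^esub>\<rho>\<in>?P. [chi_word ?d \<rho>] \<cdot>\<^bsub>V\<^esub> t \<rho> l k)"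
  proof (rule M.finsum_cong')
    fix k assume k: "k \<in> {1..n}"
    show "?F k (n - k + 1) = (\<Oplus>\<^bsub>V\<^esub>l\<in>{0..n - k}. \<Oplus>\<^bsub>V\<^esub>\<rho>\<in>?P. [chi_word ?d \<rho>] \<cdot>\<^bsub>V\<^esub> t \<rho> l k)"
      unfolding bracket_identity_arity[OF n k len hom] t_def[symmetric]
      using t_closed k by (intro M.finsum_Sigma[symmetric]) auto
  qed (use t_closed in \<open>auto intro!: M.finsum_closed\<close>)
  also have "\<dots> = finsum V (\<lambda>(k, l). \<Oplus>\<^bsub>V\<^esub>\<rho>\<in>?P. [chi_word ?d \<rho>] \<cdot>\<^bsub>V\<^esub> t \<rho> l k) (SIGMA k:{1..n}. {0..n - k})"
    using t_closed by (intro M.finsum_Sigma) (auto intro!: M.finsum_closed)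
  also have "\<dots> = finsum V (\<lambda>(l, k). \<Oplus>\<^bsub>V\<^esub>\<rho>\<in>?P. [chi_word ?d \<rho>] \<cdot>\<^bsub>V\<^esub> t \<rho> l k) ?U"
  proof (rule M.finsum_reindex_bij)
    \<comment> \<open>Both index sets describe the triangle 1 \<le> k, 0 \<le> l, k + l \<le>
      n.\<close>
    show "bij_betw prod.swap (SIGMA k:{1..n}. {0..n - k}) ?U"
      by (rule bij_betw_byWitness[where f' = prod.swap]) auto
  qed (use t_closed in \<open>auto intro!: M.finsum_closed\<close>)
  also have "\<dots> = (\<Oplus>\<^bsub>V\<^esub>p\<in>?U. \<Oplus>\<^bsub>V\<^esub>\<rho>\<in>?P. [chi_word ?d \<rho>] \<cdot>\<^bsub>V\<^esub> t \<rho> (fst p) (snd p))"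
    by (simp add: case_prod_unfold)
  also have "\<dots> = (\<Oplus>\<^bsub>V\<^esub>\<rho>\<in>?P. \<Oplus>\<^bsub>V\<^esub>p\<in>?U. [chi_word ?d \<rho>] \<cdot>\<^bsub>V\<^esub> t \<rho> (fst p) (snd p))"
    by (intro M.finsum_swap finU finite_permutations_of_set M.add.int_pow_closed tU_closed)
  also have "\<dots> = \<zero>\<^bsub>V\<^esub>"
  proof (rule M.add.finprod_one_eqI)
    fix \<rho> assume \<rho>: "\<rho> \<in> ?P"
    have "(\<Oplus>\<^bsub>V\<^esub>p\<in>?U. [chi_word ?d \<rho>] \<cdot>\<^bsub>V\<^esub> t \<rho> (fst p) (snd p))
        = [chi_word ?d \<rho>] \<cdot>\<^bsub>V\<^esub> (\<Oplus>\<^bsub>V\<^esub>p\<in>?U. t \<rho> (fst p) (snd p))"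
      using tU_closed[OF \<rho>] by (intro M.add_pow_finsum[symmetric] Pi_I)
    also have "(\<Oplus>\<^bsub>V\<^esub>p\<in>?U. t \<rho> (fst p) (snd p)) = (\<Oplus>\<^bsub>V\<^esub>l\<in>{0..n - 1}. \<Oplus>\<^bsub>V\<^esub>k\<in>{1..n - l}. t \<rho> l k)"
      using t_closed[OF \<rho>] by (subst M.finsum_Sigma) (auto simp: case_prod_unfold)
    finally show "(\<Oplus>\<^bsub>V\<^esub>p\<in>?U. [chi_word ?d \<rho>] \<cdot>\<^bsub>V\<^esub> t \<rho> (fst p) (snd p)) = \<zero>\<^bsub>V\<^esub>"
      using vanish[OF \<rho>] by simp
  qed
  finally show ?thesis .
qed

lemma bracket_L_structure: "L_structure R m V bracket"
proof (intro L_structure.intro L_structure_axioms.intro graded_vector_space_axioms)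
  show "bracket \<in> (\<Pi>\<^sub>E k\<in>arity_range m. tensor_maps R V k (int k - 2))"
    using bracket_tensor_maps by (auto simp: antisymmetrization_def)
qed (fact bracket_antisymmetric bracket_identity)+

end

section \<open>Functoriality\<close>

lemma algebra_morphismsD:
  assumes "f \<in> algebra_morphisms R m X Y"
  shows "f \<in> carrier (fst X) \<rightarrow>\<^sub>E carrier (fst Y)"
    and "x \<in> carrier (fst X) \<Longrightarrow> y \<in> carrier (fst X) \<Longrightarrow>
      f (x \<oplus>\<^bsub>fst X\<^esub> y) = f x \<oplus>\<^bsub>fst Y\<^esub> f y"
    and "c \<in> carrier R \<Longrightarrow> x \<in> carrier (fst X) \<Longrightarrow> f (c \<odot>\<^bsub>fst X\<^esub> x) = c \<odot>\<^bsub>fst Y\<^esub> f x"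
    and "x \<in> component (fst X) d \<Longrightarrow> f x \<in> component (fst Y) d"
    and "n \<in> arity_range m \<Longrightarrow> xs \<in> tensors (fst X) n \<Longrightarrow> f (snd X n xs) = snd Y n (map f xs)"
  using assms by (auto simp: algebra_morphisms_def graded_maps_def image_subset_iff)

lemma algebra_morphismsI:
  assumes "f \<in> carrier (fst X) \<rightarrow>\<^sub>E carrier (fst Y)"
    and "\<And>x y. x \<in> carrier (fst X) \<Longrightarrow> y \<in> carrier (fst X) \<Longrightarrow>
      f (x \<oplus>\<^bsub>fst X\<^esub> y) = f x \<oplus>\<^bsub>fst Y\<^esub> f y"
    and "\<And>c x. c \<in> carrier R \<Longrightarrow> x \<in> carrier (fst X) \<Longrightarrow> f (c \<odot>\<^bsub>fst X\<^esub> x) = c \<odot>\<^bsub>fst Y\<^esub> f x"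
    and "\<And>x d. x \<in> component (fst X) d \<Longrightarrow> f x \<in> component (fst Y) d"
    and "\<And>n xs. n \<in> arity_range m \<Longrightarrow> xs \<in> tensors (fst X) n \<Longrightarrow> f (snd X n xs) = snd Y n (map f xs)"
  shows "f \<in> algebra_morphisms R m X Y"
  using assms unfolding algebra_morphisms_def graded_maps_def by (auto simp: image_subset_iff)

lemma map_tensors:
  assumes "f \<in> carrier V \<rightarrow> carrier W" "xs \<in> tensors V n"
  shows "map f xs \<in> tensors W n"
  using assms by (auto simp: tensors_iff)

text \<open>Identities and composites involve the linear structure, the grading and closure under
  the operations, but not the equations between the operations. Hence one argument serves both
  categories.\<close>

lemma category_algebras:
  fixes R :: "('k, 'r) ring_scheme" and Obs :: "('k, 'v) graded_algebra set"
  assumes V: "\<And>X. X \<in> Obs \<Longrightarrow> graded_vector_space R (fst X)"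
    and closed: "\<And>X n xs. X \<in> Obs \<Longrightarrow> n \<in> arity_range m \<Longrightarrow> xs \<in> tensors (fst X) n
      \<Longrightarrow> snd X n xs \<in> carrier (fst X)"
  shows "category \<lparr>Ob = Obs, Mor = algebra_morphisms R m,
     Ident = (\<lambda>X. \<lambda>x\<in>carrier (fst X). x),
     Comp = (\<lambda>X Y Z g f. compose (carrier (fst X)) g f)\<rparr>"
proof (unfold_locales; simp only: cat.simps)
  fix X assume X: "X \<in> Obs"
  interpret X: graded_vector_space R "fst X"
    by (rule V[OF X])
  show "(\<lambda>x\<in>carrier (fst X). x) \<in> algebra_morphisms R m X X"
  proof (rule algebra_morphismsI)
    fix n xs assume *: "n \<in> arity_range m" "xs \<in> tensors (fst X) n"
    then have "map (\<lambda>x\<in>carrier (fst X). x) xs = xs"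
      by (intro map_idI) (auto simp: tensors_iff)
    then show "(\<lambda>x\<in>carrier (fst X). x) (snd X n xs) = snd X n (map (\<lambda>x\<in>carrier (fst X). x) xs)"
      using closed[OF X *] by simp
  qed (use X.component_closed in auto)
next
  fix X Y Z f g
  assume X: "X \<in> Obs" and Y: "Y \<in> Obs" and Z: "Z \<in> Obs"
    and f: "f \<in> algebra_morphisms R m X Y" and g: "g \<in> algebra_morphisms R m Y Z"
  interpret X: graded_vector_space R "fst X"
    by (rule V[OF X])
  note f = algebra_morphismsD[OF f] and g = algebra_morphismsD[OF g]
  have fX: "f x \<in> carrier (fst Y)" if "x \<in> carrier (fst X)" for x
    using f(1) that by auto
  have gY: "g y \<in> carrier (fst Z)" if "y \<in> carrier (fst Y)" for y
    using g(1) that by auto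
  show "compose (carrier (fst X)) g f \<in> algebra_morphisms R m X Z"
  proof (rule algebra_morphismsI)
    fix n xs assume *: "n \<in> arity_range m" "xs \<in> tensors (fst X) n"
    then have "map (compose (carrier (fst X)) g f) xs = map g (map f xs)"
      by (auto simp: tensors_iff compose_eq)
    moreover have "map f xs \<in> tensors (fst Y) n"
      using fX * by (intro map_tensors) auto
    ultimately show "compose (carrier (fst X)) g f (snd X n xs)
        = snd Z n (map (compose (carrier (fst X)) g f) xs)"
      using closed[OF X *] * f(5) g(5) by (simp add: compose_eq del: map_map)
  qed (use X.component_closed f g fX gY in \<open>auto simp: compose_eq compose_def\<close>)
next
  fix X Y f assume "f \<in> algebra_morphisms R m X Y"
  then have "f \<in> carrier (fst X) \<rightarrow>\<^sub>E carrier (fst Y)"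
    by (rule algebra_morphismsD(1))
  then show "compose (carrier (fst X)) f (\<lambda>x\<in>carrier (fst X). x) = f"
    and "compose (carrier (fst X)) (\<lambda>x\<in>carrier (fst Y). x) f = f"
    by (auto simp: compose_def fun_eq_iff PiE_def extensional_def restrict_def)
next
  fix W X Y Z f g h
  assume "f \<in> algebra_morphisms R m W X"
  then have "f \<in> carrier (fst W) \<rightarrow>\<^sub>E carrier (fst X)"
    by (rule algebra_morphismsD(1))
  then show "compose (carrier (fst W)) h (compose (carrier (fst W)) g f)
      = compose (carrier (fst W)) (compose (carrier (fst X)) h g) f"
    by (auto simp: compose_def fun_eq_iff restrict_def)
qed

text \<open>On homogeneous tensors the equation holds term by term: \<open>f\<close> preserves
  degrees, so both sides carry the same signs. The formula for the brackets says nothing directly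
  about other tensors; there the equation follows because both sides are additive in each
  slot.\<close>

lemma algebra_morphism_antisymmetrization:
  fixes X Y :: "('k, 'v) graded_algebra"
  assumes "A_structure R m V \<mu>" "A_structure R m W \<nu>"
    and f: "f \<in> algebra_morphisms R m (V, \<mu>) (W, \<nu>)"
  shows "f \<in> algebra_morphisms R m (V, antisymmetrization R m V \<mu>) (W, antisymmetrization R m W \<nu>)"
proof -
  interpret V: A_structure R m V \<mu> by fact
  interpret W: A_structure R m W \<nu> by fact
  note f = algebra_morphismsD[OF f, simplified]
  have fV: "f x \<in> carrier W" if "x \<in> carrier V" for x
    using f(1) that by auto
  interpret f: abelian_group_hom V W f
    using fV f(2) by (intro V.M.abelian_group_hom_into W.M.abelian_group_axioms)
  have "f (V.bracket n xs) = W.bracket n (map f xs)"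
    if n: "n \<in> arity_range m" and xs: "xs \<in> tensors V n" for n xs
  proof (rule V.multiadditive_eqI[OF W.M.abelian_group_axioms _ _ _ xs])
    have L: "multiadditive V V n (V.bracket n)" "multiadditive W W n (W.bracket n)"
      using n by (auto intro: tensor_maps_multiadditive V.bracket_tensor_maps W.bracket_tensor_maps)
    have closed: "V.bracket n xs \<in> carrier V" if "xs \<in> tensors V n" for xs
      using tensor_maps_closed[OF V.bracket_tensor_maps[OF n] that] .
    show "multiadditive V W n (\<lambda>xs. f (V.bracket n xs))"
      unfolding multiadditive_def
    proof (intro conjI allI impI)
      fix xs i x y
      assume *: "length xs = n \<and> set xs \<subseteq> carrier V \<and> i < n \<and> x \<in> carrier V \<and> y \<in> carrier V"
      then have "xs \<in> tensors V n"
        by (simp add: tensors_iff)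
      then have "xs[i := x] \<in> tensors V n" "xs[i := y] \<in> tensors V n"
        using * by (auto intro: V.tensors_update)
      then show "f (V.bracket n (xs[i := x \<oplus>\<^bsub>V\<^esub> y]))
          = f (V.bracket n (xs[i := x])) \<oplus>\<^bsub>W\<^esub> f (V.bracket n (xs[i := y]))"
        using L(1) * closed by (simp add: multiadditive_def f(2))
    qed (use closed fV in \<open>auto simp: tensors_iff\<close>)
    show "multiadditive V W n (\<lambda>xs. W.bracket n (map f xs))"
      unfolding multiadditive_def
    proof (intro conjI allI impI)
      fix xs i x y
      assume *: "length xs = n \<and> set xs \<subseteq> carrier V \<and> i < n \<and> x \<in> carrier V \<and> y \<in> carrier V"
      then have "set (map f xs) \<subseteq> carrier W" "f x \<in> carrier W" "f y \<in> carrier W"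
        using fV by auto
      then show "W.bracket n (map f (xs[i := x \<oplus>\<^bsub>V\<^esub> y]))
          = W.bracket n (map f (xs[i := x])) \<oplus>\<^bsub>W\<^esub> W.bracket n (map f (xs[i := y]))"
        using L(2) * by (simp add: multiadditive_def map_update f(2))
    next
      fix xs assume "length xs = n \<and> set xs \<subseteq> carrier V"
      then have "map f xs \<in> tensors W n"
        using fV by (auto simp: tensors_iff)
      then show "W.bracket n (map f xs) \<in> carrier W"
        using tensor_maps_closed[OF W.bracket_tensor_maps[OF n]] by blast
    qed
    fix ds xs assume len: "length xs = n" and hom: "homogeneous V ds xs"
    have homW: "homogeneous W ds (map f xs)"
      using hom f(4) by (auto simp: homogeneous_def list_all2_conv_all_nth)
    have ts: "permute_list \<sigma> xs \<in> tensors V n" if "\<sigma> permutes {..<n}" for \<sigma>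
      using tensors_permute_list[OF that V.homogeneous_tensors[OF hom len]] .
    have mu: "\<mu> n (permute_list \<sigma> xs) \<in> carrier V" if "\<sigma> permutes {..<n}" for \<sigma>
      using tensor_maps_closed[OF V.mult_tensor_maps[OF n] ts[OF that]] .
    have "f (V.bracket n xs) = (\<Oplus>\<^bsub>W\<^esub>\<sigma>\<in>{\<sigma>. \<sigma> permutes {..<n}}. f ([chi ds \<sigma>] \<cdot>\<^bsub>V\<^esub> \<mu> n (permute_list \<sigma> xs)))"
      unfolding V.bracket_homogeneous[OF n len hom] using mu by (intro f.hom_finsum) auto
    also have "\<dots> = (\<Oplus>\<^bsub>W\<^esub>\<sigma>\<in>{\<sigma>. \<sigma> permutes {..<n}}. [chi ds \<sigma>] \<cdot>\<^bsub>W\<^esub> \<nu> n (permute_list \<sigma> (map f xs)))"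
    proof (rule W.M.finsum_cong')
      fix \<sigma> assume "\<sigma> \<in> {\<sigma>. \<sigma> permutes {..<n}}"
      then have \<sigma>: "\<sigma> permutes {..<n}" by simp
      have "f (\<mu> n (permute_list \<sigma> xs)) = \<nu> n (map f (permute_list \<sigma> xs))"
        using f(5)[OF n ts[OF \<sigma>]] .
      also have "map f (permute_list \<sigma> xs) = permute_list \<sigma> (map f xs)"
        using \<sigma> len by (simp add: permute_list_map)
      finally show "f ([chi ds \<sigma>] \<cdot>\<^bsub>V\<^esub> \<mu> n (permute_list \<sigma> xs)) = [chi ds \<sigma>] \<cdot>\<^bsub>W\<^esub> \<nu> n (permute_list \<sigma> (map f xs))"
        using f.hom_add_pow_int[OF mu[OF \<sigma>]] by simp
    next
      have "\<nu> n (permute_list \<sigma> (map f xs)) \<in> carrier W" if "\<sigma> permutes {..<n}" for \<sigma>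
        using tensor_maps_closed[OF W.mult_tensor_maps[OF n]
            tensors_permute_list[OF that W.homogeneous_tensors[OF homW]]] len by simp
      then show "(\<lambda>\<sigma>. [chi ds \<sigma>] \<cdot>\<^bsub>W\<^esub> \<nu> n (permute_list \<sigma> (map f xs))) \<in> {\<sigma>. \<sigma> permutes {..<n}} \<rightarrow> carrier W"
        by auto
    qed simp
    also have "\<dots> = W.bracket n (map f xs)"
      using W.bracket_homogeneous[OF n _ homW] len by simp
    finally show "f (V.bracket n xs) = W.bracket n (map f xs)" .
  qed
  then show ?thesis
    using f by (intro algebra_morphismsI) auto
qed

lemma category_A:
  fixes R :: "('k, 'r) ring_scheme"
  shows "category (A_category R m :: (('k, 'v) graded_algebra, 'v \<Rightarrow> 'v) cat)"
proof -
  have "graded_vector_space R V" and "\<And>n xs. n \<in> arity_range m \<Longrightarrow> xs \<in> tensors V n \<Longrightarrow> \<mu> n xs \<in> carrier V"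
    if "A_structure R m V \<mu>" for V :: "('k, 'v) graded_module" and \<mu>
  proof -
    interpret A_structure R m V \<mu> by fact
    show "graded_vector_space R V"
      by (rule graded_vector_space_axioms)
    show "\<mu> n xs \<in> carrier V" if "n \<in> arity_range m" "xs \<in> tensors V n" for n xs
      using tensor_maps_closed[OF mult_tensor_maps] that by blast
  qed
  then show ?thesis
    unfolding A_category_def by (intro category_algebras) auto
qed

lemma category_L:
  fixes R :: "('k, 'r) ring_scheme"
  shows "category (L_category R m :: (('k, 'v) graded_algebra, 'v \<Rightarrow> 'v) cat)"
proof -
  have "graded_vector_space R V" and "\<And>n xs. n \<in> arity_range m \<Longrightarrow> xs \<in> tensors V n \<Longrightarrow> l n xs \<in> carrier V"
    if "L_structure R m V l" for V :: "('k, 'v) graded_module" and l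
  proof -
    interpret L_structure R m V l by fact
    show "graded_vector_space R V"
      by (rule graded_vector_space_axioms)
    show "l n xs \<in> carrier V" if "n \<in> arity_range m" "xs \<in> tensors V n" for n xs
    proof (rule tensor_maps_closed)
      show "l n \<in> tensor_maps R V n (int n - 2)"
        using PiE_mem[OF maps that(1)] .
    qed (fact that(2))
  qed
  then show ?thesis
    unfolding L_category_def by (intro category_algebras) auto
qed

theorem theorem3p1:
  fixes R :: "('k, 'r) ring_scheme" and m :: enat
  assumes "char_zero_field R" and "1 \<le> m"
  shows "(\<forall>(V :: ('k, 'v) graded_module) \<mu>. A_structure R m V \<mu> \<longrightarrow>
      (\<forall>n\<in>arity_range m. \<forall>ds vs. length vs = n \<and> homogeneous V ds vs \<longrightarrow>
         antisymmetrization R m V \<mu> n vs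
           = (\<Oplus>\<^bsub>V\<^esub>\<sigma>\<in>{\<sigma>. \<sigma> permutes {..<n}}. [chi ds \<sigma>] \<cdot>\<^bsub>V\<^esub> \<mu> n (permute_list \<sigma> vs))) \<and>
      L_structure R m V (antisymmetrization R m V \<mu>)) \<and>
    cat_functor (A_category R m) (L_category R m :: (('k, 'v) graded_algebra, 'v \<Rightarrow> 'v) cat)
      (\<lambda>(V, \<mu>). (V, antisymmetrization R m V \<mu>)) (\<lambda>X Y f. f)"
proof (intro conjI allI impI ballI)
  fix V :: "('k, 'v) graded_module" and \<mu> n ds and vs :: "'v list"
  assume "A_structure R m V \<mu>" "n \<in> arity_range m" "length vs = n \<and> homogeneous V ds vs"
  then show "antisymmetrization R m V \<mu> n vs
      = (\<Oplus>\<^bsub>V\<^esub>\<sigma>\<in>{\<sigma>. \<sigma> permutes {..<n}}. [chi ds \<sigma>] \<cdot>\<^bsub>V\<^esub> \<mu> n (permute_list \<sigma> vs))"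
    by (intro A_structure.bracket_homogeneous) auto
next
  fix V :: "('k, 'v) graded_module" and \<mu>
  assume "A_structure R m V \<mu>"
  then show "L_structure R m V (antisymmetrization R m V \<mu>)"
    by (rule A_structure.bracket_L_structure)
next
  show "cat_functor (A_category R m) (L_category R m :: (('k, 'v) graded_algebra, 'v \<Rightarrow> 'v) cat)
      (\<lambda>(V, \<mu>). (V, antisymmetrization R m V \<mu>)) (\<lambda>X Y f. f)"
  proof (intro cat_functor.intro cat_functor_axioms.intro category_A category_L)
    fix X :: "('k, 'v) graded_algebra"
    assume "X \<in> Ob (A_category R m)"
    then show "(\<lambda>(V, \<mu>). (V, antisymmetrization R m V \<mu>)) X \<in> Ob (L_category R m)"
      by (auto simp: A_category_def L_category_def A_structure.bracket_L_structure)
  next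
    fix X Y :: "('k, 'v) graded_algebra" and f
    assume "X \<in> Ob (A_category R m)" "Y \<in> Ob (A_category R m)" "f \<in> Mor (A_category R m) X Y"
    then show "f \<in> Mor (L_category R m) ((\<lambda>(V, \<mu>). (V, antisymmetrization R m V \<mu>)) X)
        ((\<lambda>(V, \<mu>). (V, antisymmetrization R m V \<mu>)) Y)"
      by (auto simp: A_category_def L_category_def algebra_morphism_antisymmetrization)
  qed (auto simp: A_category_def L_category_def)
qed

end
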